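(* Let $a$ be an arbitrary complex number not equal to $e_1,e_2,e_3$, and let the numbers $\alpha_1,\alpha_2\in\mathbb{C}$ be such that $\wp(\alpha_j|\Lambda)=a$ for $j=1,2$. Let also the difference $\alpha_1-\alpha_2\neq 2n\omega_1+2m\omega_2$ for all $n,m\in\mathbb{Z}$. Then $$\wp(z|\Lambda)-a=C\,\frac{\theta_1\!\left(\frac{\pi z}{2\omega_1}-\frac{\pi\alpha_1}{2\omega_1},\,q\right)\theta_1\!\left(\frac{\pi z}{2\omega_1}-\frac{\pi\alpha_2}{2\omega_1},\,q\right)}{\theta_1^2\!\left(\frac{\pi z}{2\omega_1},\,q\right)},$$ where $\tau=\omega_2/\omega_1$, $q=e^{i\pi\tau}$, and $$C=\frac{\pi^2}{4\omega_1^2}\,\frac{\theta_1'^2(0,q)}{\theta_1\!\left(\frac{\pi\alpha_1}{2\omega_1},q\right)\theta_1\!\left(\frac{\pi\alpha_2}{2\omega_1},q\right)}.$$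
   Context: $\omega_1,\omega_2$ are complex numbers with $\operatorname{Im}(\omega_2/\omega_1)>0$, and $\Lambda=\{2m\omega_1+2n\omega_2: m,n\in\mathbb{Z}\}$ is the corresponding lattice. $\wp(z|\Lambda)$ is the Weierstrass $\wp$-function of $\Lambda$: $\wp(z|\Lambda)=-\frac{d^2}{dz^2}\ln\sigma(z|\Lambda)$, where $\sigma(z|\Lambda)=z\prod_{\omega\in\Lambda\setminus\{0\}}\left(1-\frac{z}{\omega}\right)\exp\left(\frac{z}{\omega}+\frac{z^2}{2\omega^2}\right)$. Put $e_1=\wp(\omega_1|\Lambda)$, $e_2=\wp(\omega_2|\Lambda)$, $e_3=\wp(\omega_1+\omega_2|\Lambda)$. For $q=e^{i\pi\tau}$ with $\operatorname{Im}\tau>0$, where $q^{s}$ means $e^{i\pi\tau s}$, $$\theta_1(z,q)=\theta_1(z|\tau)=2\sum_{n=0}^\infty(-1)^nq^{(n+1/2)^2}\sin((2n+1)z),$$ and $\theta_1'(0,q)$ denotes its derivative in $z$ at $z=0$; $\theta_1'^2(0,q)=(\theta_1'(0,q))^2$.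
   Formalization: Added assumption: α₁+α₂ is not of the form 2nω₁+2mω₂ with m≠0. For such m (e.g. α₂=−α₁+2ω₂) the right-hand side equals exp(iπmz/ω₁)(℘(z)−a), so the printed identity fails. *)

theory Defs
  imports "HOL-Complex_Analysis.Complex_Analysis"
begin

definition period_lattice :: "complex \<Rightarrow> complex \<Rightarrow> complex set" where
  "period_lattice \<omega>\<^sub>1 \<omega>\<^sub>2 = {2 * of_int m * \<omega>\<^sub>1 + 2 * of_int n * \<omega>\<^sub>2 | m n :: int. True}"

text \<open>
  The product over the nonzero lattice points is unordered: it is the limit of the finite
  partial products along the filter of finite subsets, in analogy with \<^const>\<open>infsum\<close>.
\<close>
definition weierstrass_sigma :: "complex set \<Rightarrow> complex \<Rightarrow> complex" where
  "weierstrass_sigma \<Lambda> z =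
     z * Lim (finite_subsets_at_top (\<Lambda> - {0}))
           (\<lambda>F. \<Prod>\<omega>\<in>F. (1 - z / \<omega>) * exp (z / \<omega> + z\<^sup>2 / (2 * \<omega>\<^sup>2)))"

text \<open>
  The second derivative of the logarithm of sigma is expressed as the derivative of the
  logarithmic derivative of sigma, which is the derivative of every local branch of its logarithm;
  \<^const>\<open>Ln\<close> itself would bring in spurious branch cuts. The value at lattice points, which are
  the poles, carries no meaning.
\<close>
definition weierstrass_p :: "complex set \<Rightarrow> complex \<Rightarrow> complex" where
  "weierstrass_p \<Lambda> z =
     - deriv (\<lambda>w. deriv (weierstrass_sigma \<Lambda>) w / weierstrass_sigma \<Lambda> w) z"

text \<open>
  The second argument is \<open>\<tau>\<close> rather than the nome \<open>q\<close>, because the fractional powers of \<open>q\<close>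
  depend on the choice of \<open>\<tau>\<close>.
\<close>
definition nome_power :: "complex \<Rightarrow> complex \<Rightarrow> complex" where
  "nome_power \<tau> s = exp (\<i> * of_real pi * \<tau> * s)"

definition theta1 :: "complex \<Rightarrow> complex \<Rightarrow> complex" where
  "theta1 z \<tau> =
     2 * (\<Sum>n. (-1) ^ n * nome_power \<tau> ((of_nat n + 1 / 2)\<^sup>2) * sin ((2 * of_nat n + 1) * z))"

end

theory Submission
  imports Defs
begin

text \<open>
  Write \<open>\<theta>\<close> for the theta function in the variable \<open>v\<close> with \<open>z = 2 \<omega>\<^sub>1 v / \<pi>\<close>. The entire functions with
  the same quasi-periodicity as \<open>\<theta>\<^sup>2\<close> form a space of dimension at most two, since such a function is
  determined by two of its Fourier coefficients. Both \<open>\<theta>\<^sup>2\<close> and the product of \<open>\<theta>\<^sup>2\<close> with the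
  Weierstrass function lie in that space and are independent, so they form a basis, and every
  product \<open>\<theta> (v - b) \<theta> (v + b)\<close> is a combination of them. If \<open>\<theta>\<close> vanished at a point outside the
  lattice, all these products would vanish there, which is impossible; hence the zeros of \<open>\<theta>\<close> are the
  lattice points, without an appeal to the argument principle. Taking \<open>b\<close> with image \<open>\<alpha>\<^sub>1\<close> and
  comparing values at \<open>b\<close> and at \<open>0\<close> determines the two coefficients. The resulting identity, read at
  \<open>\<alpha>\<^sub>2\<close>, also shows that \<open>\<alpha>\<^sub>1 + \<alpha>\<^sub>2\<close> is a lattice point.
\<close>

text \<open>Three obstacles shape the argument. Periodicity of the Weierstrass function must come
  from the product for sigma. The series of its logarithmic derivative converges only with
  correction terms that destroy translation invariance, so second divided differences are taken, in
  which these terms cancel. Next, the product of the Weierstrass function with the square of theta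
  has to be an entire function. Its poles are cleared by squaring the quotient of theta by sigma,
  which requires that the zeros of sigma are simple. Finally, two Fourier coefficients suffice
  because a shift by \<open>pi * \<tau>\<close> links the coefficient of index k to that of index k
  + 2. This needs a uniqueness statement for Fourier coefficients but no convergence of Fourier
  series. The basis argument delivers a product of theta at \<open>v - a1\<close> and
  \<open>v + a1\<close>, whereas the claim has \<open>v - a2\<close>. Passing from one to the other
  is a shift by a period of the lattice. It costs only a sign if the period is a multiple of
  \<open>2 * \<omega>\<^sub>1\<close>, but an exponential in \<open>v\<close> otherwise.\<close>

section \<open>Products and quotients of entire functions\<close>

text \<open>Bridges the unordered product that defines sigma and the sequential
  \<open>prodinf\<close>. Once a finite set contains an initial segment, its remaining factors
  multiply to something within exp(tail) - 1 of 1, where the tail of the sum of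
  \<open>norm (u k - 1)\<close> tends to 0.\<close>

lemma finite_subsets_prod_tendsto_prodinf:
  fixes u :: "nat \<Rightarrow> complex"
  assumes "abs_convergent_prod u"
  shows "((\<lambda>F. \<Prod>k\<in>F. u k) \<longlongrightarrow> prodinf u) (finite_subsets_at_top UNIV)"
proof -
  have summ: "summable (\<lambda>k. norm (u k - 1))"
    using assms by (simp add: abs_convergent_prod_conv_summable)
  define T where "T n = (\<Sum>k. norm (u (k + n) - 1))" for n
  have T0: "T \<longlonglongrightarrow> 0"
    unfolding T_def using suminf_exist_split2[OF summ] by simp
  have lim: "(\<lambda>n. \<Prod>k<n. u k) \<longlonglongrightarrow> prodinf u"
    using convergent_prod_LIMSEQ[OF abs_convergent_prod_imp_convergent_prod[OF assms]]
    by (subst LIMSEQ_lessThan_iff_atMost)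
  have key: "norm ((\<Prod>k\<in>F. u k) - (\<Prod>k<n. u k)) \<le> norm (\<Prod>k<n. u k) * (exp (T n) - 1)"
    if F: "finite F" "{..<n} \<subseteq> F" for F n
  proof -
    have "(\<Prod>k\<in>F. u k) = (\<Prod>k<n. u k) * (\<Prod>k\<in>F - {..<n}. u k)"
      using prod.subset_diff[OF F(2,1), of u] by (simp add: mult.commute)
    hence "norm ((\<Prod>k\<in>F. u k) - (\<Prod>k<n. u k)) =
             norm (\<Prod>k<n. u k) * norm ((\<Prod>k\<in>F - {..<n}. u k) - 1)"
      by (simp add: norm_mult [symmetric] algebra_simps)
    also have "norm ((\<Prod>k\<in>F - {..<n}. u k) - 1) \<le> (\<Prod>k\<in>F - {..<n}. 1 + norm (u k - 1)) - 1"
      using norm_prod_minus1_le_prod_minus1[of "\<lambda>k. u k - 1" "F - {..<n}"] by simp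
    also have "(\<Prod>k\<in>F - {..<n}. 1 + norm (u k - 1)) \<le> exp (\<Sum>k\<in>F - {..<n}. norm (u k - 1))"
      by (rule prod_le_exp_sum) auto
    also have "(\<Sum>k\<in>F - {..<n}. norm (u k - 1)) = (\<Sum>k\<in>(\<lambda>k. k - n) ` (F - {..<n}). norm (u (k + n) - 1))"
      by (subst sum.reindex) (auto simp: inj_on_def intro!: sum.cong)
    also have "\<dots> \<le> T n"
      unfolding T_def using F by (intro sum_le_suminf summable_ignore_initial_segment summ) auto
    finally show ?thesis by (simp add: mult_left_mono)
  qed
  have lim2: "(\<lambda>n. norm (\<Prod>k<n. u k) * (exp (T n) - 1) + norm ((\<Prod>k<n. u k) - prodinf u)) \<longlonglongrightarrow> 0"
  proof -
    have "(\<lambda>n. norm (\<Prod>k<n. u k) * (exp (T n) - 1) + norm ((\<Prod>k<n. u k) - prodinf u))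
            \<longlonglongrightarrow> norm (prodinf u) * (exp 0 - 1) + norm (prodinf u - prodinf u)"
      by (intro tendsto_intros lim T0)
    thus ?thesis by simp
  qed
  show ?thesis
  proof (rule tendstoI)
    fix e :: real assume "e > 0"
    then obtain n where n: "norm (\<Prod>k<n. u k) * (exp (T n) - 1) + norm ((\<Prod>k<n. u k) - prodinf u) < e"
      using order_tendstoD(2)[OF lim2] eventually_sequentially by (meson order_refl)
    show "\<forall>\<^sub>F F in finite_subsets_at_top UNIV. dist (\<Prod>k\<in>F. u k) (prodinf u) < e"
      unfolding eventually_finite_subsets_at_top
    proof (intro exI[of _ "{..<n}"] conjI allI impI)
      fix F assume F: "finite F \<and> {..<n} \<subseteq> F \<and> F \<subseteq> UNIV"
      have "dist (\<Prod>k\<in>F. u k) (prodinf u) \<le>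
              norm ((\<Prod>k\<in>F. u k) - (\<Prod>k<n. u k)) + norm ((\<Prod>k<n. u k) - prodinf u)"
        using norm_triangle_ineq[of "(\<Prod>k\<in>F. u k) - (\<Prod>k<n. u k)" "(\<Prod>k<n. u k) - prodinf u"]
        by (simp add: dist_norm)
      thus "dist (\<Prod>k\<in>F. u k) (prodinf u) < e"
        using key[of F n] F n by auto
    qed auto
  qed
qed

text \<open>The quotient has removable singularities. At a zero of \<open>B\<close> its value is the
  limit of the ratio of difference quotients, which exists because the zero is simple. It serves for
  theta over sigma and for the division by 1 - E in the uniqueness of Fourier coefficients.\<close>

lemma holomorphic_quotient_simple_zeros:
  assumes A: "A holomorphic_on UNIV" and B: "B holomorphic_on UNIV"
    and simple: "\<And>z. B z = 0 \<Longrightarrow> deriv B z \<noteq> 0"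
    and zero: "\<And>z. B z = 0 \<Longrightarrow> A z = 0"
  obtains h where "h holomorphic_on UNIV" "\<And>z. A z = h z * B z"
proof -
  define h where "h z = (if B z = 0 then deriv A z / deriv B z else A z / B z)" for z
  have eq: "A z = h z * B z" for z
    by (simp add: h_def zero)
  have dA: "(A has_field_derivative deriv A z) (at z)" and dB: "(B has_field_derivative deriv B z) (at z)" for z
    using A B by (auto intro!: holomorphic_derivI)
  have hol: "h field_differentiable at z" for z
  proof -
    \<comment> \<open>The ball contains no zero of \<open>B\<close> except possibly its centre, so
      that only one singularity has to be removed at a time.\<close>
    obtain r where r: "r > 0" "\<And>w. w \<in> ball z r \<Longrightarrow> w \<noteq> z \<Longrightarrow> B w \<noteq> 0"
    proof (cases "B z = 0")
      case True
      have "eventually (\<lambda>w. B w \<noteq> 0) (at z)"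
      proof -
        have "((\<lambda>w. (B w - B z) / (w - z)) \<longlongrightarrow> deriv B z) (at z)"
          using dB by (simp add: has_field_derivative_iff)
        from tendsto_imp_eventually_ne[OF this simple[OF True]] show ?thesis
          by eventually_elim (use True in auto)
      qed
      thus ?thesis
        using that unfolding eventually_at by (auto simp: dist_commute)
    next
      case False
      have "continuous (at z) B"
        using dB DERIV_isCont by blast
      from continuous_at_avoid[OF this False] show ?thesis
        using that by (metis dist_commute mem_ball)
    qed
    have *: "h holomorphic_on ball z r - {z}"
    proof -
      have "(\<lambda>w. A w / B w) holomorphic_on ball z r - {z}"
        using r by (intro holomorphic_on_divide holomorphic_on_subset[OF A] holomorphic_on_subset[OF B]) auto
      thus ?thesis
        by (rule holomorphic_transform) (use r in \<open>auto simp: h_def\<close>)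
    qed
    have lim: "(h \<longlongrightarrow> h z) (at z)"
    proof (cases "B z = 0")
      case True
      have "((\<lambda>w. ((A w - A z) / (w - z)) / ((B w - B z) / (w - z))) \<longlongrightarrow> deriv A z / deriv B z) (at z)"
        using dA[of z] dB[of z] by (intro tendsto_divide simple True) (auto simp: has_field_derivative_iff)
      hence "((\<lambda>w. ((A w - A z) / (w - z)) / ((B w - B z) / (w - z))) \<longlongrightarrow> h z) (at z)"
        using True by (simp add: h_def)
      moreover have "\<forall>\<^sub>F w in at z. ((A w - A z) / (w - z)) / ((B w - B z) / (w - z)) = h w"
        unfolding eventually_at
        by (intro exI[of _ r]) (use r True zero in \<open>auto simp: h_def dist_commute divide_simps\<close>)
      ultimately show ?thesis
        by (simp add: tendsto_cong)
    next
      case False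
      have "((\<lambda>w. A w / B w) \<longlongrightarrow> A z / B z) (at z)"
        using dA[of z] dB[of z] False DERIV_isCont isContD by (intro tendsto_divide) blast+
      moreover have "\<forall>\<^sub>F w in at z. A w / B w = h w"
        unfolding eventually_at
        by (intro exI[of _ r]) (use r False in \<open>auto simp: h_def dist_commute\<close>)
      ultimately have "(h \<longlongrightarrow> A z / B z) (at z)"
        by (rule Lim_transform_eventually)
      thus ?thesis
        using False by (simp add: h_def)
    qed
    have "h holomorphic_on ball z r"
      by (rule no_isolated_singularity'[of "{z}"]) (use * lim in \<open>auto intro: tendsto_within_subset\<close>)
    thus ?thesis
      using r by (auto simp: holomorphic_on_open field_differentiable_def)
  qed
  show ?thesis
    by (rule that[OF _ eq]) (auto simp: holomorphic_on_def field_differentiable_at_within hol)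
qed

lemma summable_on_int_powr:
  fixes s :: real
  assumes "s > 1"
  shows "(\<lambda>m::int. (1 + real_of_int \<bar>m\<bar>) powr (-s)) summable_on UNIV"
proof -
  have "summable (\<lambda>n. real n powr (-s))"
    using assms by (simp add: summable_real_powr_iff)
  hence "summable (\<lambda>n. real (Suc n) powr (-s))"
    by (subst summable_Suc_iff)
  hence nat: "(\<lambda>n::nat. (1 + real n) powr (-s)) summable_on UNIV"
    by (subst summable_on_UNIV_nonneg_real_iff) (auto simp: add_ac)
  have "(\<lambda>m::int. (1 + real_of_int \<bar>m\<bar>) powr (-s)) summable_on range int"
    by (subst summable_on_reindex) (use nat in \<open>auto simp: o_def\<close>)
  moreover have "(\<lambda>m::int. (1 + real_of_int \<bar>m\<bar>) powr (-s)) summable_on range (\<lambda>n. - int n)"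
    by (subst summable_on_reindex) (use nat in \<open>auto simp: o_def inj_on_def\<close>)
  ultimately have "(\<lambda>m::int. (1 + real_of_int \<bar>m\<bar>) powr (-s)) summable_on range int \<union> range (\<lambda>n. - int n)"
    by (rule summable_on_union)
  also have "range int \<union> range (\<lambda>n. - int n) = UNIV"
    by (auto simp: image_iff) (metis int_cases2)
  finally show ?thesis .
qed

section \<open>Summation over the period lattice\<close>

locale complex_lattice =
  fixes \<omega>\<^sub>1 \<omega>\<^sub>2 :: complex
  assumes Im_pos: "Im (\<omega>\<^sub>2 / \<omega>\<^sub>1) > 0"
begin

definition \<Lambda> :: "complex set" where "\<Lambda> = period_lattice \<omega>\<^sub>1 \<omega>\<^sub>2"

lemma \<omega>\<^sub>1_nonzero: "\<omega>\<^sub>1 \<noteq> 0"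
  using Im_pos by auto

text \<open>After division by \<open>2 * \<omega>\<^sub>1\<close> the imaginary part of the lattice
  point is n times Im tau, which controls n; the triangle inequality then controls m. Both the
  injectivity of the parametrisation and the convergence of lattice sums rest on this bound.\<close>

lemma lattice_bound:
  obtains K where "K > 0"
    "\<And>m n :: int. max \<bar>real_of_int m\<bar> \<bar>real_of_int n\<bar> \<le> K * norm (2 * of_int m * \<omega>\<^sub>1 + 2 * of_int n * \<omega>\<^sub>2)"
proof -
  define \<tau> where "\<tau> = \<omega>\<^sub>2 / \<omega>\<^sub>1"
  define t where "t = Im \<tau>"
  have t: "t > 0" using Im_pos by (simp add: t_def \<tau>_def)
  \<comment> \<open>The summand 1 / t bounds n, the other two bound m; their sum bounds the maximum
    of both.\<close>
  define L where "L = 1 / t + 1 + norm \<tau> / t"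
  have L: "L > 0" using t by (simp add: L_def add_pos_nonneg)
  define K where "K = L / (2 * norm \<omega>\<^sub>1)"
  have *: "max \<bar>real_of_int m\<bar> \<bar>real_of_int n\<bar> \<le> L * norm (of_int m + of_int n * \<tau>)" for m n :: int
  proof -
    let ?w = "of_int m + of_int n * \<tau>"
    have "\<bar>real_of_int n\<bar> * t = \<bar>Im ?w\<bar>"
      using t by (simp add: t_def abs_mult)
    also have "\<dots> \<le> norm ?w" by (rule abs_Im_le_cmod)
    finally have n: "\<bar>real_of_int n\<bar> \<le> norm ?w / t"
      using t by (simp add: field_simps)
    have "\<bar>real_of_int m\<bar> = norm (?w - of_int n * \<tau>)"
      by simp
    also have "\<dots> \<le> norm ?w + \<bar>real_of_int n\<bar> * norm \<tau>"
      by (rule order_trans[OF norm_triangle_ineq4]) (simp add: norm_mult)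
    also have "\<dots> \<le> norm ?w + norm ?w / t * norm \<tau>"
      by (intro add_left_mono mult_right_mono n) auto
    finally have m: "\<bar>real_of_int m\<bar> \<le> norm ?w + norm ?w / t * norm \<tau>" .
    have "0 \<le> norm ?w / t" "0 \<le> norm ?w / t * norm \<tau>" using t by auto
    hence "max \<bar>real_of_int m\<bar> \<bar>real_of_int n\<bar> \<le> norm ?w / t + norm ?w + norm ?w / t * norm \<tau>"
      using m n norm_ge_zero[of ?w] by (simp only: max_def split: if_split) linarith
    also have "\<dots> = L * norm ?w" by (simp add: L_def algebra_simps)
    finally show ?thesis .
  qed
  show ?thesis
  proof (rule that[of K])
    show "K > 0" using L \<omega>\<^sub>1_nonzero by (simp add: K_def)
    fix m n :: int
    have "2 * of_int m * \<omega>\<^sub>1 + 2 * of_int n * \<omega>\<^sub>2 = 2 * \<omega>\<^sub>1 * (of_int m + of_int n * \<tau>)"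
      using \<omega>\<^sub>1_nonzero by (simp add: \<tau>_def algebra_simps)
    hence "K * norm (2 * of_int m * \<omega>\<^sub>1 + 2 * of_int n * \<omega>\<^sub>2) = L * norm (of_int m + of_int n * \<tau>)"
      using \<omega>\<^sub>1_nonzero by (simp add: K_def norm_mult)
    thus "max \<bar>real_of_int m\<bar> \<bar>real_of_int n\<bar> \<le> K * norm (2 * of_int m * \<omega>\<^sub>1 + 2 * of_int n * \<omega>\<^sub>2)"
      using *[of m n] by simp
  qed
qed

definition lattice_point :: "int \<times> int \<Rightarrow> complex" where
  "lattice_point = (\<lambda>(m, n). 2 * of_int m * \<omega>\<^sub>1 + 2 * of_int n * \<omega>\<^sub>2)"

lemma lattice_point_diff: "lattice_point x - lattice_point y = lattice_point (x - y)"
  by (cases x; cases y) (simp add: lattice_point_def algebra_simps)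

lemma lattice_point_eq_0_iff: "lattice_point x = 0 \<longleftrightarrow> x = 0"
proof
  obtain K where K: "K > 0" "\<And>m n :: int. max \<bar>real_of_int m\<bar> \<bar>real_of_int n\<bar> \<le>
      K * norm (2 * of_int m * \<omega>\<^sub>1 + 2 * of_int n * \<omega>\<^sub>2)"
    by (rule lattice_bound) blast
  obtain m n where x: "x = (m, n)" by (cases x)
  assume "lattice_point x = 0"
  hence "max \<bar>real_of_int m\<bar> \<bar>real_of_int n\<bar> \<le> 0"
    using K(2)[of m n] unfolding x lattice_point_def by simp
  thus "x = 0" by (auto simp: x zero_prod_def)
qed (auto simp: lattice_point_def zero_prod_def)

lemma inj_lattice_point: "inj lattice_point"
  by (rule injI) (metis lattice_point_diff lattice_point_eq_0_iff right_minus_eq)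

lemma lattice_eq: "\<Lambda> = range lattice_point"
  unfolding \<Lambda>_def period_lattice_def lattice_point_def by force

lemma lattice_minus_0: "\<Lambda> - {0} = lattice_point ` (UNIV - {0})"
  unfolding lattice_eq using lattice_point_eq_0_iff by auto

lemma lattice_diff: "x \<in> \<Lambda> \<Longrightarrow> y \<in> \<Lambda> \<Longrightarrow> x - y \<in> \<Lambda>"
  unfolding lattice_eq by (auto simp: lattice_point_diff)

lemma lattice_0: "0 \<in> \<Lambda>"
  unfolding lattice_eq using lattice_point_eq_0_iff[of 0] by (metis rangeI)

lemma lattice_uminus: "x \<in> \<Lambda> \<Longrightarrow> -x \<in> \<Lambda>"
  using lattice_diff[OF lattice_0, of x] by simp

lemma lattice_add: "x \<in> \<Lambda> \<Longrightarrow> y \<in> \<Lambda> \<Longrightarrow> x + y \<in> \<Lambda>"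
  using lattice_diff[OF _ lattice_uminus, of x y] by simp

text \<open>A half period in the lattice would, after doubling, equate an odd coordinate 1 with an
  even one.\<close>

lemma half_period_notin:
  assumes "\<omega> = \<omega>\<^sub>1 \<or> \<omega> = \<omega>\<^sub>2"
  shows "2 * \<omega> \<in> \<Lambda>" "\<omega> \<notin> \<Lambda>"
proof -
  have e: "2 * \<omega>\<^sub>1 = lattice_point (1, 0)" "2 * \<omega>\<^sub>2 = lattice_point (0, 1)"
    by (simp_all add: lattice_point_def)
  thus "2 * \<omega> \<in> \<Lambda>"
    using assms unfolding lattice_eq by auto
  show "\<omega> \<notin> \<Lambda>"
  proof
    assume "\<omega> \<in> \<Lambda>"
    then obtain m n where mn: "\<omega> = lattice_point (m, n)"
      unfolding lattice_eq by auto
    have "2 * lattice_point (m, n) = lattice_point (2 * m, 2 * n)"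
      by (simp add: lattice_point_def algebra_simps)
    hence "lattice_point (1, 0) = lattice_point (2 * m, 2 * n) \<or> lattice_point (0, 1) = lattice_point (2 * m, 2 * n)"
      using assms mn e by auto
    hence "(1, 0) = (2 * m, 2 * n) \<or> (0, 1) = (2 * m, 2 * n)"
      using injD[OF inj_lattice_point] by metis
    thus False by (auto; presburger)
  qed
qed

lemma lattice_summable: "(\<lambda>w. 1 / norm w ^ 3) summable_on \<Lambda> - {0}"
proof -
  obtain K where K: "K > 0" "\<And>m n :: int. max \<bar>real_of_int m\<bar> \<bar>real_of_int n\<bar> \<le>
      K * norm (2 * of_int m * \<omega>\<^sub>1 + 2 * of_int n * \<omega>\<^sub>2)"
    by (rule lattice_bound) blast
  \<comment> \<open>The cube is divided evenly between the two coordinates: (1 + |m|)(1 + |n|) is at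
    most the square of 2 K times the norm of the lattice point, and the power -3/2 of that square is
    a cube. As 3/2 > 1, the double series is dominated by a product of two convergent
    series.\<close>
  define b :: "int \<Rightarrow> real" where "b m = (1 + real_of_int \<bar>m\<bar>) powr (-(3/2))" for m
  have b: "b summable_on UNIV"
    unfolding b_def by (rule summable_on_int_powr) auto
  have b0: "b m > 0" for m
    by (auto simp: b_def)
  have "(\<lambda>(m, n). b m * b n) summable_on UNIV \<times> UNIV"
  proof (rule summable_on_SigmaI[where g = "\<lambda>m. b m * infsum b UNIV"])
    show "((\<lambda>n. case (m, n) of (m, n) \<Rightarrow> b m * b n) has_sum b m * infsum b UNIV) UNIV" for m
      using b by (auto intro: has_sum_cmult_right)
    show "(\<lambda>m. b m * infsum b UNIV) summable_on UNIV"
      using b by (rule summable_on_cmult_left)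
    show "\<And>m n. 0 \<le> (case (m, n) of (m, n) \<Rightarrow> b m * b n)"
      using b0 by (auto intro!: less_imp_le)
  qed
  hence "(\<lambda>(m, n). b m * b n) summable_on (UNIV - {0})"
    by (rule summable_on_subset) auto
  hence "(\<lambda>x. (8 * K ^ 3) * (case x of (m, n) \<Rightarrow> b m * b n)) summable_on (UNIV - {0})"
    by (rule summable_on_cmult_right)
  hence "(\<lambda>x. 1 / norm (lattice_point x) ^ 3) summable_on (UNIV - {0})"
  proof (rule summable_on_comparison_test)
    fix x :: "int \<times> int" assume x: "x \<in> UNIV - {0}"
    obtain m n where mn: "x = (m, n)" by (cases x)
    let ?M = "max \<bar>real_of_int m\<bar> \<bar>real_of_int n\<bar>"
    have M: "?M \<ge> 1"
      using x by (auto simp: mn zero_prod_def)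
    have pos: "norm (lattice_point x) > 0"
      using lattice_point_eq_0_iff x by auto
    have le: "?M \<le> K * norm (lattice_point x)"
      using K(2)[of m n] by (simp add: mn lattice_point_def)
    have "(1 + real_of_int \<bar>m\<bar>) * (1 + real_of_int \<bar>n\<bar>) \<le> (2 * ?M) * (2 * ?M)"
      using M by (intro mult_mono) auto
    also have "\<dots> \<le> (2 * (K * norm (lattice_point x))) * (2 * (K * norm (lattice_point x)))"
      using M le by (intro mult_mono) auto
    finally have "((2 * (K * norm (lattice_point x))) * (2 * (K * norm (lattice_point x)))) powr (-(3/2)) \<le>
                  ((1 + real_of_int \<bar>m\<bar>) * (1 + real_of_int \<bar>n\<bar>)) powr (-(3/2))"
      by (intro powr_mono2') (auto intro!: mult_pos_pos)
    also have "\<dots> = b m * b n"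
      by (simp add: b_def powr_mult)
    also have "((2 * (K * norm (lattice_point x))) * (2 * (K * norm (lattice_point x)))) powr (-(3/2)) =
               ((2 * (K * norm (lattice_point x))) powr 2) powr (-(3/2))"
      using K(1) pos by (simp add: power2_eq_square)
    also have "\<dots> = (2 * (K * norm (lattice_point x))) powr (-3)"
      by (subst powr_powr) simp
    also have "\<dots> = 1 / (2 * (K * norm (lattice_point x))) ^ 3"
      using K(1) pos by (simp add: powr_minus divide_simps)
    also have "\<dots> = 1 / (8 * K ^ 3) * (1 / norm (lattice_point x) ^ 3)"
      by (simp add: power_mult_distrib)
    finally have "1 / (8 * K ^ 3) * (1 / norm (lattice_point x) ^ 3) \<le> b m * b n" .
    hence "8 * K ^ 3 * (1 / (8 * K ^ 3) * (1 / norm (lattice_point x) ^ 3)) \<le> 8 * K ^ 3 * (b m * b n)"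
      using K(1) by (intro mult_left_mono) auto
    thus "1 / norm (lattice_point x) ^ 3 \<le> 8 * K ^ 3 * (case x of (m, n) \<Rightarrow> b m * b n)"
      using K(1) by (simp add: mn)
  qed auto
  thus ?thesis
    unfolding lattice_minus_0 using inj_on_subset[OF inj_lattice_point]
    by (subst summable_on_reindex) (auto simp: o_def)
qed

lemma countable_lattice: "countable \<Lambda>"
  by (simp add: lattice_eq)

lemma infinite_lattice: "infinite (\<Lambda> - {0})"
proof -
  have "infinite (UNIV :: (int \<times> int) set)"
    by (simp add: finite_prod)
  thus ?thesis
    unfolding lattice_eq using finite_imageD[OF _ inj_lattice_point] by auto
qed

end

section \<open>Sigma, zeta and the Weierstrass function\<close>

text \<open>This and the next two lemmas evaluate the second divided difference at three nodes for
  the constant 1, the identity and t -> 1 / (t - c). The first two vanish because the functions have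
  degree at most one.\<close>

lemma divided_difference_1:
  fixes z w x :: "'a :: field"
  assumes "z \<noteq> w" "w \<noteq> x" "z \<noteq> x"
  shows "1 / ((z - w) * (z - x)) + 1 / ((w - z) * (w - x)) + 1 / ((x - z) * (x - w)) = 0"
proof -
  have "z - w \<noteq> 0" "w - z \<noteq> 0" "w - x \<noteq> 0" "x - w \<noteq> 0" "z - x \<noteq> 0" "x - z \<noteq> 0"
    using assms by auto
  thus ?thesis
    by (simp add: add_divide_eq_iff divide_add_eq_iff) (simp add: algebra_simps)
qed

lemma divided_difference_id:
  fixes z w x :: "'a :: field"
  assumes "z \<noteq> w" "w \<noteq> x" "z \<noteq> x"
  shows "z / ((z - w) * (z - x)) + w / ((w - z) * (w - x)) + x / ((x - z) * (x - w)) = 0"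
proof -
  have "z - w \<noteq> 0" "w - z \<noteq> 0" "w - x \<noteq> 0" "x - w \<noteq> 0" "z - x \<noteq> 0" "x - z \<noteq> 0"
    using assms by auto
  thus ?thesis
    by (simp add: add_divide_eq_iff divide_add_eq_iff) (simp add: algebra_simps)
qed

lemma divided_difference_inverse:
  fixes z w x c :: "'a :: field"
  assumes "z \<noteq> w" "w \<noteq> x" "z \<noteq> x" "z \<noteq> c" "w \<noteq> c" "x \<noteq> c"
  shows "1 / (z - c) / ((z - w) * (z - x)) + 1 / (w - c) / ((w - z) * (w - x)) +
         1 / (x - c) / ((x - z) * (x - w)) = 1 / ((z - c) * (w - c) * (x - c))"
proof -
  have "z - w \<noteq> 0" "w - z \<noteq> 0" "w - x \<noteq> 0" "x - w \<noteq> 0" "z - x \<noteq> 0" "x - z \<noteq> 0"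
       "z - c \<noteq> 0" "w - c \<noteq> 0" "x - c \<noteq> 0"
    using assms by auto
  thus ?thesis
    by (simp add: divide_simps) (simp add: algebra_simps)
qed

text \<open>Linear interpolation: a vanishing second divided difference determines the value at the
  first node from the other two.\<close>

lemma divided_difference_eq_0D:
  fixes z w x :: "'a :: field"
  assumes "z \<noteq> w" "w \<noteq> x" "z \<noteq> x"
    and "A / ((z - w) * (z - x)) + B / ((w - z) * (w - x)) + C / ((x - z) * (x - w)) = 0"
  shows "A * (w - x) = B * (z - x) - C * (z - w)"
proof -
  let ?d = "(z - w) * (z - x) * (w - x)"
  have nz: "z - w \<noteq> 0" "w - z \<noteq> 0" "w - x \<noteq> 0" "x - w \<noteq> 0" "z - x \<noteq> 0" "x - z \<noteq> 0"
    using assms by auto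
  have "?d * (A / ((z - w) * (z - x))) = A * (w - x)"
    using nz by simp
  moreover have "?d * (B / ((w - z) * (w - x))) = - (B * (z - x))"
    using nz by (simp add: divide_simps) (simp add: algebra_simps)
  moreover have "?d * (C / ((x - z) * (x - w))) = C * (z - w)"
    using nz by (simp add: divide_simps) (simp add: algebra_simps)
  moreover have "?d * (A / ((z - w) * (z - x)) + B / ((w - z) * (w - x)) + C / ((x - z) * (x - w))) = 0"
    using assms(4) by simp
  ultimately show ?thesis
    by (simp only: distrib_left) (simp add: algebra_simps)
qed

lemma weierstrass_factor_2_div:
  "weierstrass_factor 2 (z / w) = (1 - z / w) * exp (z / w + z\<^sup>2 / (2 * w\<^sup>2))"
  by (simp add: weierstrass_factor_def numeral_2_eq_2 power_divide mult.commute)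

text \<open>The right-hand side is the general term of the partial fraction series of the
  Weierstrass zeta function.\<close>

lemma logderiv_weierstrass_factor_2:
  assumes "w \<noteq> 0" "z \<noteq> w"
  shows "deriv (\<lambda>z. weierstrass_factor 2 (z / w)) z / weierstrass_factor 2 (z / w) =
           1 / (z - w) + 1 / w + z / w\<^sup>2"
proof -
  have "((\<lambda>z. z / w + z\<^sup>2 / (2 * w\<^sup>2)) has_field_derivative (1 / w + z / w\<^sup>2)) (at z)"
    using assms by (auto intro!: derivative_eq_intros simp: power2_eq_square)
  hence "((\<lambda>z. exp (z / w + z\<^sup>2 / (2 * w\<^sup>2))) has_field_derivative
          exp (z / w + z\<^sup>2 / (2 * w\<^sup>2)) * (1 / w + z / w\<^sup>2)) (at z)"
    by (rule DERIV_chain2[OF DERIV_exp])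
  moreover have "((\<lambda>z. 1 - z / w) has_field_derivative (-1 / w)) (at z)"
    using assms by (auto intro!: derivative_eq_intros)
  ultimately have "((\<lambda>z. weierstrass_factor 2 (z / w)) has_field_derivative
          (-1 / w) * exp (z / w + z\<^sup>2 / (2 * w\<^sup>2)) +
          exp (z / w + z\<^sup>2 / (2 * w\<^sup>2)) * (1 / w + z / w\<^sup>2) * (1 - z / w)) (at z)"
    unfolding weierstrass_factor_2_div by (intro DERIV_mult)
  also have "(-1 / w) * exp (z / w + z\<^sup>2 / (2 * w\<^sup>2)) +
          exp (z / w + z\<^sup>2 / (2 * w\<^sup>2)) * (1 / w + z / w\<^sup>2) * (1 - z / w) =
          (-1 / w + (1 - z / w) * (1 / w + z / w\<^sup>2)) * exp (z / w + z\<^sup>2 / (2 * w\<^sup>2))"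
    by (simp only: distrib_right distrib_left mult_ac)
  finally have "((\<lambda>z. weierstrass_factor 2 (z / w)) has_field_derivative
          (-1 / w + (1 - z / w) * (1 / w + z / w\<^sup>2)) * exp (z / w + z\<^sup>2 / (2 * w\<^sup>2))) (at z)" .
  hence "deriv (\<lambda>z. weierstrass_factor 2 (z / w)) z / weierstrass_factor 2 (z / w) =
          (-1 / w + (1 - z / w) * (1 / w + z / w\<^sup>2)) / (1 - z / w)"
    by (subst DERIV_imp_deriv) (auto simp: weierstrass_factor_2_div)
  also have "\<dots> = (-1 / w) / (1 - z / w) + (1 / w + z / w\<^sup>2)"
  proof -
    have "1 - z / w \<noteq> 0" using assms by (simp add: field_simps)
    thus ?thesis by (subst add_divide_distrib) simp
  qed
  also have "(-1 / w) / (1 - z / w) = 1 / (z - w)"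
    using assms by (simp add: divide_simps)
  finally show ?thesis by (simp add: add_ac)
qed

context complex_lattice
begin

text \<open>Weierstrass products are indexed by natural numbers, so the nonzero lattice points are
  put in some order. Absolute convergence makes the choice immaterial.\<close>

definition lattice_enum :: "nat \<Rightarrow> complex" where "lattice_enum = from_nat_into (\<Lambda> - {0})"

lemma bij_lattice_enum: "bij_betw lattice_enum UNIV (\<Lambda> - {0})"
  unfolding lattice_enum_def using countable_lattice infinite_lattice by (intro bij_betw_from_nat_into) auto

lemma range_lattice_enum: "range lattice_enum = \<Lambda> - {0}"
  using bij_lattice_enum by (simp add: bij_betw_def)

lemma lattice_enum_nonzero: "lattice_enum n \<noteq> 0"
  using range_lattice_enum by auto

lemma summable_lattice_enum: "summable (\<lambda>n. 1 / norm (lattice_enum n) ^ 3)"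
proof -
  have "(\<lambda>n. 1 / norm (lattice_enum n) ^ 3) summable_on UNIV"
    using lattice_summable summable_on_reindex_bij_betw[OF bij_lattice_enum] by fast
  thus ?thesis by (rule summable_on_imp_summable)
qed

lemma filterlim_lattice_enum: "filterlim lattice_enum at_infinity at_top"
proof -
  have "(\<lambda>n. root 3 (1 / norm (lattice_enum n) ^ 3)) \<longlonglongrightarrow> root 3 0"
    by (intro tendsto_real_root summable_LIMSEQ_zero summable_lattice_enum)
  moreover have "root 3 (1 / norm (lattice_enum n) ^ 3) = norm (inverse (lattice_enum n))" for n
    using real_root_power_cancel[of 3 "norm (inverse (lattice_enum n))"]
    by (simp add: norm_divide norm_inverse power_one_over inverse_eq_divide)
  ultimately have "(\<lambda>n. norm (inverse (lattice_enum n))) \<longlonglongrightarrow> 0"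
    by simp
  hence "(\<lambda>n. inverse (lattice_enum n)) \<longlonglongrightarrow> 0"
    by (simp only: tendsto_norm_zero_iff)
  hence "filterlim (\<lambda>n. inverse (lattice_enum n)) (at 0) at_top"
    using lattice_enum_nonzero by (simp add: filterlim_at)
  hence "filterlim (\<lambda>n. inverse (inverse (lattice_enum n))) at_infinity at_top"
    using filterlim_compose filterlim_inverse_at_infinity by blast
  thus ?thesis by simp
qed

text \<open>The constant 2 is the degree of the polynomial in the exponential factor; convergence
  then needs the sum of the inverse cubes.\<close>

sublocale wprod: weierstrass_product lattice_enum "\<lambda>_. 2"
proof
  show "summable (\<lambda>n. (r / norm (lattice_enum n)) ^ Suc 2)" for r
    using summable_mult[OF summable_lattice_enum, of "r ^ 3"] by (simp add: power_divide eval_nat_numeral)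
qed (use lattice_enum_nonzero filterlim_lattice_enum in auto)

abbreviation \<sigma> :: "complex \<Rightarrow> complex" where "\<sigma> \<equiv> weierstrass_sigma \<Lambda>"

abbreviation wp :: "complex \<Rightarrow> complex" where "wp \<equiv> weierstrass_p \<Lambda>"

text \<open>The Weierstrass zeta function of the lattice, whose negated derivative is
  \<open>wp\<close>.\<close>

definition \<zeta> :: "complex \<Rightarrow> complex" where "\<zeta> z = deriv \<sigma> z / \<sigma> z"

lemma sigma_eq: "\<sigma> z = z * wprod.f z"
proof -
  have "((\<lambda>F. \<Prod>k\<in>F. weierstrass_factor 2 (z / lattice_enum k)) \<longlongrightarrow> wprod.f z) (finite_subsets_at_top UNIV)"
    unfolding wprod.f_def using wprod.abs_convergent by (rule finite_subsets_prod_tendsto_prodinf)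
  also have "?this \<longleftrightarrow> ((\<lambda>F. \<Prod>w\<in>lattice_enum ` F. weierstrass_factor 2 (z / w)) \<longlongrightarrow> wprod.f z) (finite_subsets_at_top UNIV)"
    using bij_lattice_enum by (intro tendsto_cong always_eventually allI)
      (subst prod.reindex, auto simp: bij_betw_def intro: inj_on_subset)
  also have "\<dots> \<longleftrightarrow> ((\<lambda>F. \<Prod>w\<in>F. weierstrass_factor 2 (z / w)) \<longlongrightarrow> wprod.f z)
                      (filtermap ((`) lattice_enum) (finite_subsets_at_top UNIV))"
    by (simp add: filterlim_filtermap)
  also have "filtermap ((`) lattice_enum) (finite_subsets_at_top UNIV) = finite_subsets_at_top (\<Lambda> - {0})"
    using filtermap_image_finite_subsets_at_top[of lattice_enum UNIV] bij_lattice_enum by (simp add: bij_betw_def)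
  finally have "((\<lambda>F. \<Prod>w\<in>F. weierstrass_factor 2 (z / w)) \<longlongrightarrow> wprod.f z) (finite_subsets_at_top (\<Lambda> - {0}))" .
  thus ?thesis
    unfolding weierstrass_sigma_def weierstrass_factor_2_div
    by (subst tendsto_Lim) auto
qed

section \<open>Simple zeros of sigma and the partial fractions of zeta\<close>

lemma sigma_holomorphic: "\<sigma> holomorphic_on A"
  unfolding sigma_eq [abs_def] by (intro holomorphic_intros wprod.holomorphic)

lemma sigma_deriv: "(\<sigma> has_field_derivative deriv \<sigma> z) (at z)"
  using sigma_holomorphic[of UNIV] by (auto intro: holomorphic_derivI)

lemma sigma_eq_0_iff: "\<sigma> z = 0 \<longleftrightarrow> z \<in> \<Lambda>"
  using lattice_0 by (auto simp: sigma_eq wprod.zero range_lattice_enum)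

lemma wprod_0: "wprod.f 0 = 1"
  by (simp add: wprod.f_def)

lemma deriv_sigma: "deriv \<sigma> z = wprod.f z + z * deriv wprod.f z"
proof -
  have "(wprod.f has_field_derivative deriv wprod.f z) (at z)"
    using wprod.holomorphic[of UNIV] by (auto intro: holomorphic_derivI)
  thus ?thesis
    unfolding sigma_eq [abs_def] by (intro DERIV_imp_deriv) (auto intro!: derivative_eq_intros)
qed

lemma deriv_sigma_0: "deriv \<sigma> 0 = 1"
  by (simp add: deriv_sigma wprod_0)

lemma deriv_sigma_nonzero:
  assumes "\<sigma> z = 0"
  shows "deriv \<sigma> z \<noteq> 0"
proof (cases "z = 0")
  case True
  thus ?thesis by (simp add: deriv_sigma_0)
next
  case False
  hence z: "z \<in> range lattice_enum" using assms by (simp add: sigma_eq_0_iff range_lattice_enum)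
  have hol: "wprod.f holomorphic_on UNIV" by (rule wprod.holomorphic)
  \<comment> \<open>The order of a zero of the product is the number of indices enumerating that
    point, which is one by injectivity.\<close>
  have "lattice_enum -` {z} = {inv lattice_enum z}"
    using z bij_lattice_enum by (auto simp: bij_betw_def inj_on_def f_inv_into_f)
  hence ord: "zorder wprod.f z = 1"
    by (simp add: wprod.zorder)
  have f0: "wprod.f z = 0" using z by (simp add: wprod.zero)
  have ev: "\<exists>\<^sub>F w in at z. wprod.f w \<noteq> 0"
    using wprod.isolated_zero[OF z] unfolding isolated_zero_def
    by (auto intro: eventually_frequently)
  have "deriv wprod.f z \<noteq> 0"
  proof
    assume d: "deriv wprod.f z = 0"
    obtain r where r: "r > 0"
      "\<forall>w\<in>cball z r. wprod.f w = zor_poly wprod.f z w * (w - z) ^ nat (zorder wprod.f z) \<and> zor_poly wprod.f z w \<noteq> 0"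
      "zor_poly wprod.f z holomorphic_on cball z r"
      using zorder_exist_zero[of wprod.f UNIV z] hol f0 ev by (auto simp: wprod_0 intro: that) (metis UNIV_I connected_UNIV open_UNIV wprod_0 zero_neq_one)
    let ?h = "zor_poly wprod.f z"
    have "(?h has_field_derivative deriv ?h z) (at z)"
      using r by (intro holomorphic_derivI[of _ "ball z r"]) (auto intro: holomorphic_on_subset)
    \<comment> \<open>With order one the function is locally \<open>?h w * (w - z)\<close>, so its
      derivative at \<open>z\<close> is \<open>?h z\<close>, which is nonzero.\<close>
    hence "((\<lambda>w. ?h w * (w - z)) has_field_derivative ?h z) (at z)"
      by (auto intro!: derivative_eq_intros)
    moreover have "\<forall>\<^sub>F w in nhds z. ?h w * (w - z) = wprod.f w"
      using r ord unfolding eventually_nhds_metric by (intro exI[of _ r]) (auto simp: dist_commute)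
    ultimately have "(wprod.f has_field_derivative ?h z) (at z)"
      by (simp add: DERIV_cong_ev[OF refl _ refl])
    hence "deriv wprod.f z = ?h z" by (rule DERIV_imp_deriv)
    thus False using d r by auto
  qed
  thus ?thesis
    using False f0 by (simp add: deriv_sigma)
qed

lemma closed_lattice: "closed \<Lambda>"
proof -
  have "closed {z. \<sigma> z = 0}"
    by (intro closed_Collect_eq holomorphic_on_imp_continuous_on sigma_holomorphic continuous_on_const)
  thus ?thesis by (simp add: sigma_eq_0_iff)
qed

lemma zeta_holomorphic: "\<zeta> holomorphic_on -\<Lambda>"
  unfolding \<zeta>_def [abs_def]
  by (intro holomorphic_on_divide holomorphic_deriv sigma_holomorphic) (use closed_lattice sigma_eq_0_iff in auto)

lemma zeta_has_derivative: "z \<notin> \<Lambda> \<Longrightarrow> (\<zeta> has_field_derivative - wp z) (at z)"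
  using holomorphic_derivI[OF zeta_holomorphic, of z] closed_lattice
  by (simp add: weierstrass_p_def \<zeta>_def [abs_def] open_Compl)

text \<open>Separates the poles from an entire numerator; \<open>wp_numerator\<close> below is this
  numerator in the scaled variable.\<close>

lemma wp_eq:
  assumes "z \<notin> \<Lambda>"
  shows "wp z = ((deriv \<sigma> z)\<^sup>2 - \<sigma> z * deriv (deriv \<sigma>) z) / (\<sigma> z)\<^sup>2"
proof -
  have nz: "\<sigma> z \<noteq> 0" using assms by (simp add: sigma_eq_0_iff)
  have "(deriv \<sigma> has_field_derivative deriv (deriv \<sigma>) z) (at z)"
    by (rule holomorphic_derivI[of _ UNIV]) (auto intro: holomorphic_deriv sigma_holomorphic)
  hence "(\<zeta> has_field_derivative (deriv (deriv \<sigma>) z * \<sigma> z - deriv \<sigma> z * deriv \<sigma> z) / (\<sigma> z * \<sigma> z)) (at z)"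
    unfolding \<zeta>_def [abs_def] using sigma_deriv nz by (rule DERIV_divide)
  from DERIV_unique[OF this zeta_has_derivative[OF assms]]
  have "wp z = - ((deriv (deriv \<sigma>) z * \<sigma> z - deriv \<sigma> z * deriv \<sigma> z) / (\<sigma> z * \<sigma> z))"
    by simp
  thus ?thesis by (simp add: power2_eq_square minus_divide_left mult.commute)
qed

text \<open>Logarithmic differentiation of the product gives a series along the enumeration. Its
  terms equal z^2 / ((z - w) w^2), hence it converges absolutely and may be read as an unordered
  sum. That form is what permits reindexing by negation and by translation of the lattice.\<close>

lemma zeta_has_sum:
  assumes "z \<notin> \<Lambda>"
  shows "((\<lambda>w. 1 / (z - w) + 1 / w + z / w\<^sup>2) has_sum (\<zeta> z - 1 / z)) (\<Lambda> - {0})"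
proof -
  have z0: "z \<noteq> 0" using assms lattice_0 by auto
  have a_notz: "z \<noteq> lattice_enum k" for k using assms range_lattice_enum by auto
  have f0: "wprod.f z \<noteq> 0" using assms range_lattice_enum by (auto simp: wprod.zero)
  have "uniform_limit (cball 0 (norm z + 1)) (\<lambda>N z. \<Prod>n<N. weierstrass_factor 2 (z / lattice_enum n)) wprod.f at_top"
    by (rule wprod.uniform_limit) (auto intro: add_nonneg_pos)
  hence "uniform_limit (ball 0 (norm z + 1)) (\<lambda>N z. \<Prod>n<N. weierstrass_factor 2 (z / lattice_enum n)) wprod.f at_top"
    by (rule uniform_limit_on_subset) auto
  from logderiv_prodinf_complex_uniform_limit[OF this, of z]
  have "(\<lambda>k. deriv (\<lambda>z. weierstrass_factor 2 (z / lattice_enum k)) z / weierstrass_factor 2 (z / lattice_enum k))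
          sums (deriv wprod.f z / wprod.f z)"
    using f0 lattice_enum_nonzero by (simp add: holomorphic_intros add_nonneg_pos)
  hence sums: "(\<lambda>k. 1 / (z - lattice_enum k) + 1 / lattice_enum k + z / (lattice_enum k)\<^sup>2) sums (deriv wprod.f z / wprod.f z)"
    by (simp add: logderiv_weierstrass_factor_2 lattice_enum_nonzero a_notz)
  have eq: "deriv wprod.f z / wprod.f z = \<zeta> z - 1 / z"
    using z0 f0 by (simp add: \<zeta>_def deriv_sigma sigma_eq field_simps)
  have "summable (\<lambda>k. norm (1 / (z - lattice_enum k) + 1 / lattice_enum k + z / (lattice_enum k)\<^sup>2))"
  proof (rule summable_comparison_test_ev)
    show "summable (\<lambda>k. 2 * norm z ^ 2 * (1 / norm (lattice_enum k) ^ 3))"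
      by (intro summable_mult summable_lattice_enum)
    \<comment> \<open>Beyond this radius \<open>norm (z - w)\<close> is at least half of
      \<open>norm w\<close>, whence the factor 2 in the majorant.\<close>
    have "eventually (\<lambda>n. norm (lattice_enum n) > 2 * norm z) at_top"
      using filterlim_lattice_enum by (metis filterlim_at_infinity_imp_norm_at_top filterlim_at_top_dense)
    thus "\<forall>\<^sub>F k in sequentially. norm (norm (1 / (z - lattice_enum k) + 1 / lattice_enum k + z / (lattice_enum k)\<^sup>2)) \<le>
            2 * norm z ^ 2 * (1 / norm (lattice_enum k) ^ 3)"
    proof eventually_elim
      case (elim k)
      have "1 / (z - lattice_enum k) + 1 / lattice_enum k + z / (lattice_enum k)\<^sup>2 = z\<^sup>2 / ((z - lattice_enum k) * (lattice_enum k)\<^sup>2)"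
        using lattice_enum_nonzero[of k] a_notz[of k] by (simp add: field_simps power2_eq_square)
      hence "norm (1 / (z - lattice_enum k) + 1 / lattice_enum k + z / (lattice_enum k)\<^sup>2) = norm z ^ 2 / (norm (z - lattice_enum k) * norm (lattice_enum k) ^ 2)"
        by (simp add: norm_divide norm_mult norm_power)
      also have "norm (lattice_enum k) \<le> norm (z - lattice_enum k) + norm z"
        by (metis norm_minus_commute norm_triangle_sub add.commute)
      hence "norm z ^ 2 / (norm (z - lattice_enum k) * norm (lattice_enum k) ^ 2) \<le> norm z ^ 2 / (norm (lattice_enum k) / 2 * norm (lattice_enum k) ^ 2)"
        using elim lattice_enum_nonzero[of k] a_notz[of k]
        by (intro divide_left_mono mult_right_mono mult_pos_pos) auto
      also have "\<dots> = 2 * norm z ^ 2 * (1 / norm (lattice_enum k) ^ 3)"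
        by (simp add: eval_nat_numeral)
      finally show ?case by simp
    qed
  qed
  from norm_summable_imp_has_sum[OF this sums] show ?thesis
    unfolding eq using has_sum_reindex_bij_betw[OF bij_lattice_enum] by fast
qed

section \<open>Parity and periodicity of the Weierstrass function\<close>

lemma zeta_uminus:
  assumes "z \<notin> \<Lambda>"
  shows "\<zeta> (-z) = - \<zeta> z"
proof -
  have z': "-z \<notin> \<Lambda>" using assms lattice_uminus[of "-z"] by auto
  have bij: "bij_betw uminus (\<Lambda> - {0}) (\<Lambda> - {0})"
    by (rule bij_betwI[where g = uminus]) (auto simp: lattice_uminus)
  have "((\<lambda>w. 1 / (-z - -w) + 1 / -w + -z / (-w)\<^sup>2) has_sum (\<zeta> (-z) - 1 / (-z))) (\<Lambda> - {0})"
    using zeta_has_sum[OF z'] by (subst has_sum_reindex_bij_betw[OF bij])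
  moreover have "1 / (-z - -w) + 1 / -w + -z / (-w)\<^sup>2 = - (1 / (z - w) + 1 / w + z / w\<^sup>2)" for w
  proof -
    have "-z - -w = -(z - w)" by simp
    thus ?thesis
      by (simp only: minus_divide_right[symmetric] power2_minus minus_divide_left[symmetric]) simp
  qed
  ultimately have "((\<lambda>w. - (1 / (z - w) + 1 / w + z / w\<^sup>2)) has_sum (\<zeta> (-z) - 1 / (-z))) (\<Lambda> - {0})"
    by simp
  moreover have "((\<lambda>w. - (1 / (z - w) + 1 / w + z / w\<^sup>2)) has_sum - (\<zeta> z - 1 / z)) (\<Lambda> - {0})"
    using zeta_has_sum[OF assms] by (rule has_sum_uminusI)
  ultimately show ?thesis
    using has_sum_unique by fastforce
qed

lemma wp_uminus:
  assumes "z \<notin> \<Lambda>"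
  shows "wp (-z) = wp z"
proof -
  have z': "-z \<notin> \<Lambda>" using assms lattice_uminus[of "-z"] by auto
  have "((\<lambda>z. \<zeta> (-z)) has_field_derivative (- wp (-z)) * (-1)) (at z)"
    by (rule DERIV_chain2[where f = \<zeta> and g = uminus, OF zeta_has_derivative[OF z']]) (auto intro!: derivative_eq_intros)
  moreover have "((\<lambda>z. - \<zeta> z) has_field_derivative - (- wp z)) (at z)"
    by (intro DERIV_minus zeta_has_derivative assms)
  moreover have "\<forall>\<^sub>F w in nhds z. \<zeta> (-w) = - \<zeta> w"
    using assms closed_lattice eventually_nhds_in_open[of "-\<Lambda>" z]
    by (auto simp: open_Compl zeta_uminus elim!: eventually_mono)
  ultimately show ?thesis
    using DERIV_cong_ev[OF refl _ refl] DERIV_unique by fastforce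
qed

text \<open>
  In a second divided difference of zeta the affine terms that make the series converge drop out. What
  remains is absolutely convergent and visibly invariant under simultaneous translation of the three points
  by a period, so zeta changes by an affine function under such a translation.
\<close>

lemma zeta_divided_difference:
  assumes "z \<notin> \<Lambda>" "w \<notin> \<Lambda>" "x \<notin> \<Lambda>" "z \<noteq> w" "w \<noteq> x" "z \<noteq> x"
  shows "((\<lambda>c. 1 / ((z - c) * (w - c) * (x - c))) has_sum
           (\<zeta> z / ((z - w) * (z - x)) + \<zeta> w / ((w - z) * (w - x)) + \<zeta> x / ((x - z) * (x - w)))) \<Lambda>"
proof -
  let ?p = "(z - w) * (z - x)" and ?q = "(w - z) * (w - x)" and ?r = "(x - z) * (x - w)"
  let ?t = "\<lambda>z c. 1 / (z - c) + 1 / c + z / c\<^sup>2"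
  have "((\<lambda>c. ?t z c / ?p + ?t w c / ?q + ?t x c / ?r) has_sum
          (\<zeta> z - 1 / z) / ?p + (\<zeta> w - 1 / w) / ?q + (\<zeta> x - 1 / x) / ?r) (\<Lambda> - {0})"
    by (intro has_sum_add has_sum_divide_const zeta_has_sum assms)
  also have "?this \<longleftrightarrow> ((\<lambda>c. 1 / ((z - c) * (w - c) * (x - c))) has_sum
          (\<zeta> z - 1 / z) / ?p + (\<zeta> w - 1 / w) / ?q + (\<zeta> x - 1 / x) / ?r) (\<Lambda> - {0})"
  proof (rule has_sum_cong)
    fix c assume c: "c \<in> \<Lambda> - {0}"
    have "?t z c / ?p + ?t w c / ?q + ?t x c / ?r =
          (1 / (z - c) / ?p + 1 / (w - c) / ?q + 1 / (x - c) / ?r) +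
          1 / c * (1 / ?p + 1 / ?q + 1 / ?r) + 1 / c\<^sup>2 * (z / ?p + w / ?q + x / ?r)"
      by (simp add: add_divide_distrib distrib_left mult.commute)
    also have "1 / ?p + 1 / ?q + 1 / ?r = 0"
      using assms by (intro divided_difference_1)
    also have "z / ?p + w / ?q + x / ?r = 0"
      using assms by (intro divided_difference_id)
    also have "1 / (z - c) / ?p + 1 / (w - c) / ?q + 1 / (x - c) / ?r = 1 / ((z - c) * (w - c) * (x - c))"
      using assms c by (intro divided_difference_inverse) auto
    finally show "?t z c / ?p + ?t w c / ?q + ?t x c / ?r = 1 / ((z - c) * (w - c) * (x - c))"
      by simp
  qed
  \<comment> \<open>The terms 1 / z, 1 / w and 1 / x, absent from the sums over nonzero lattice
    points, combine to the contribution of the lattice point 0.\<close>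
  finally have "((\<lambda>c. 1 / ((z - c) * (w - c) * (x - c))) has_sum
          1 / ((z - 0) * (w - 0) * (x - 0)) +
          ((\<zeta> z - 1 / z) / ?p + (\<zeta> w - 1 / w) / ?q + (\<zeta> x - 1 / x) / ?r)) (insert 0 (\<Lambda> - {0}))"
    by (intro has_sum_insert) auto
  also have "insert 0 (\<Lambda> - {0}) = \<Lambda>"
    using lattice_0 by auto
  also have "1 / ((z - 0) * (w - 0) * (x - 0)) = 1 / (z - 0) / ?p + 1 / (w - 0) / ?q + 1 / (x - 0) / ?r"
    using assms lattice_0 by (intro divided_difference_inverse[symmetric]) auto
  finally show ?thesis
    by (simp add: diff_divide_distrib add_ac)
qed

text \<open>The increment of zeta under the period is affine, so that of \<open>wp\<close> is
  constant. Evenness of \<open>wp\<close> shows that this constant is 0.\<close>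

lemma wp_add_period:
  assumes "\<omega> = \<omega>\<^sub>1 \<or> \<omega> = \<omega>\<^sub>2" "z \<notin> \<Lambda>"
  shows "wp (z + 2 * \<omega>) = wp z"
proof -
  define l where "l = 2 * \<omega>"
  have l: "l \<in> \<Lambda>" and \<omega>: "\<omega> \<notin> \<Lambda>"
    using half_period_notin[OF assms(1)] by (auto simp: l_def)
  have shift: "x + l \<notin> \<Lambda>" if "x \<notin> \<Lambda>" for x
    using lattice_diff[of "x + l" l] l that by auto
  define P where "P x = \<zeta> (x + l) - \<zeta> x" for x
  have P: "P z / ((z - w) * (z - x)) + P w / ((w - z) * (w - x)) + P x / ((x - z) * (x - w)) = 0"
    if *: "z \<notin> \<Lambda>" "w \<notin> \<Lambda>" "x \<notin> \<Lambda>" "z \<noteq> w" "w \<noteq> x" "z \<noteq> x" for z w x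
  proof -
    have bij: "bij_betw (\<lambda>c. c + l) \<Lambda> \<Lambda>"
      by (rule bij_betwI[where g = "\<lambda>c. c - l"]) (use l in \<open>auto intro: lattice_add lattice_diff\<close>)
    have "((\<lambda>c. 1 / ((z + l - c) * (w + l - c) * (x + l - c))) has_sum
           (\<zeta> (z + l) / ((z - w) * (z - x)) + \<zeta> (w + l) / ((w - z) * (w - x)) +
            \<zeta> (x + l) / ((x - z) * (x - w)))) \<Lambda>"
      using zeta_divided_difference[of "z + l" "w + l" "x + l"] * shift by simp
    hence "((\<lambda>c. 1 / ((z + l - (c + l)) * (w + l - (c + l)) * (x + l - (c + l)))) has_sum
           (\<zeta> (z + l) / ((z - w) * (z - x)) + \<zeta> (w + l) / ((w - z) * (w - x)) +
            \<zeta> (x + l) / ((x - z) * (x - w)))) \<Lambda>"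
      by (subst has_sum_reindex_bij_betw[OF bij])
    hence "((\<lambda>c. 1 / ((z - c) * (w - c) * (x - c))) has_sum
           (\<zeta> (z + l) / ((z - w) * (z - x)) + \<zeta> (w + l) / ((w - z) * (w - x)) +
            \<zeta> (x + l) / ((x - z) * (x - w)))) \<Lambda>"
      by simp
    from has_sum_unique[OF this zeta_divided_difference[OF *]] show ?thesis
      by (simp add: P_def diff_divide_distrib algebra_simps)
  qed
  \<comment> \<open>Two distinct points off the lattice, serving as interpolation nodes for the
    affine function.\<close>
  define w x where "w = \<omega>" and "x = \<omega> + l"
  have wx: "w \<notin> \<Lambda>" "x \<notin> \<Lambda>" "w \<noteq> x"
    using \<omega> shift[OF \<omega>] lattice_0 by (auto simp: w_def x_def l_def)
  define A where "A = (P w - P x) / (w - x)"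
  define B where "B = P w - A * w"
  have affine: "P y = A * y + B" if y: "y \<notin> \<Lambda>" for y
  proof -
    consider "y = w" | "y = x" | "y \<noteq> w" "y \<noteq> x" by blast
    thus ?thesis
    proof cases
      case 2
      have "A * (w - x) = P w - P x" using wx by (simp add: A_def)
      thus ?thesis using 2 by (simp add: B_def algebra_simps)
    next
      case 3
      have "P y * (w - x) = P w * (y - x) - P x * (y - w)"
        using 3 wx y by (intro divided_difference_eq_0D P) auto
      also have "\<dots> = P w * (w - x) + (P w - P x) * (y - w)"
        by (simp add: algebra_simps)
      also have "P w - P x = A * (w - x)"
        using wx by (simp add: A_def)
      also have "P w * (w - x) + A * (w - x) * (y - w) = (A * y + B) * (w - x)"
        by (simp add: B_def algebra_simps)
      finally show ?thesis using wx by simp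
    qed (simp add: B_def)
  qed
  have deriv: "wp (y + l) - wp y = -A" if y: "y \<notin> \<Lambda>" for y
  proof -
    have "((\<lambda>y. \<zeta> (y + l)) has_field_derivative - wp (y + l)) (at y)"
      using zeta_has_derivative[OF shift[OF y]] by (simp add: DERIV_shift)
    hence "(P has_field_derivative (- wp (y + l) - - wp y)) (at y)"
      unfolding P_def [abs_def] by (intro DERIV_diff zeta_has_derivative y)
    moreover have "((\<lambda>y. A * y + B) has_field_derivative A) (at y)"
      by (auto intro!: derivative_eq_intros)
    moreover have "\<forall>\<^sub>F w in nhds y. P w = A * w + B"
      using y closed_lattice eventually_nhds_in_open[of "-\<Lambda>" y]
      by (auto simp: open_Compl affine elim!: eventually_mono)
    ultimately have "- wp (y + l) - - wp y = A"
      using DERIV_cong_ev[OF refl _ refl] DERIV_unique by metis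
    thus ?thesis by (simp add: algebra_simps)
  qed
  \<comment> \<open>Translation by \<open>2 * \<omega>\<close> carries \<open>-\<omega>\<close> to
    \<open>\<omega>\<close>, where \<open>wp\<close> has the same value by evenness.\<close>
  have "-\<omega> \<notin> \<Lambda>" using \<omega> lattice_uminus[of "-\<omega>"] by auto
  from deriv[OF this] have "A = 0"
    using wp_uminus[OF \<omega>] by (simp add: l_def)
  with deriv[OF assms(2)] show ?thesis by (simp add: l_def)
qed

end

section \<open>Fourier coefficients of entire periodic functions\<close>

lemma entire_affine:
  assumes "f holomorphic_on UNIV"
  shows "(\<lambda>w. f (c * w + d)) holomorphic_on A"
  using holomorphic_on_compose_gen[of "\<lambda>w. c * w + d" A f UNIV] assms
  by (simp add: o_def holomorphic_intros)

text \<open>Entire functions have no zero divisors: \<open>B\<close> is nonzero on a disc, so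
  \<open>A\<close> vanishes there and hence everywhere. Together with the cancellation rule that
  follows, it carries identities across points where a quotient is undefined.\<close>

lemma entire_mult_eq_0:
  assumes "A holomorphic_on UNIV" "B holomorphic_on UNIV" "\<And>z. A z * B z = 0" "B w \<noteq> 0"
  shows "A z = 0"
proof -
  have "continuous (at w) B"
    using assms(2) by (meson UNIV_I holomorphic_on_imp_continuous_on continuous_on_eq_continuous_at open_UNIV)
  from continuous_at_avoid[OF this assms(4)] obtain e where e: "e > 0" "\<And>y. dist w y < e \<Longrightarrow> B y \<noteq> 0"
    by auto
  show ?thesis
  proof (rule analytic_continuation_open[of "ball w e" UNIV A "\<lambda>_. 0"])
    fix y assume "y \<in> ball w e"
    thus "A y = 0" using e(2)[of y] assms(3)[of y] by simp
  qed (use e assms in auto)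
qed

lemma entire_eqI:
  assumes "A holomorphic_on UNIV" "B holomorphic_on UNIV" "C holomorphic_on UNIV"
    and "\<And>z. A z * C z = B z * C z" "C w \<noteq> 0"
  shows "A z = B z"
proof -
  have "A z - B z = 0"
    by (rule entire_mult_eq_0[of "\<lambda>z. A z - B z" C w])
       (use assms in \<open>auto intro: holomorphic_intros simp: left_diff_distrib\<close>)
  thus ?thesis by simp
qed

text \<open>The base point is a parameter because paths at different heights will be
  compared.\<close>

definition period_integral :: "complex \<Rightarrow> (complex \<Rightarrow> complex) \<Rightarrow> complex" where
  "period_integral p f = contour_integral (linepath p (p + of_real pi)) f"

lemma entire_primitive:
  assumes "f holomorphic_on UNIV"
  obtains F where "\<And>z. (F has_field_derivative f z) (at z)"
    "\<And>p. period_integral p f = F (p + of_real pi) - F p"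
proof -
  obtain F where F: "\<And>z. (F has_field_derivative f z) (at z)"
    using holomorphic_convex_primitive'[of UNIV f] assms by auto
  have "period_integral p f = F (p + of_real pi) - F p" for p
    unfolding period_integral_def
    using contour_integral_primitive[of UNIV F f "linepath p (p + of_real pi)"] F
    by (auto intro!: contour_integral_unique)
  with F show ?thesis by (rule that)
qed

text \<open>For a primitive \<open>F\<close>, the integral is the increment of \<open>F\<close> over
  a period; its derivative in the base point is f(z + pi) - f(z) = 0. This replaces a rectangular
  contour.\<close>

lemma period_integral_indep:
  assumes "f holomorphic_on UNIV" "\<And>z. f (z + of_real pi) = f z"
  shows "period_integral p f = period_integral q f"
proof -
  obtain F where F: "\<And>z. (F has_field_derivative f z) (at z)"
    "\<And>p. period_integral p f = F (p + of_real pi) - F p"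
    using entire_primitive[OF assms(1)] by blast
  have "((\<lambda>z. F (z + of_real pi) - F z) has_field_derivative 0) (at z)" for z
    using DERIV_diff[OF _ F(1)[of z], of "\<lambda>z. F (z + of_real pi)" "f z"] F(1)[of "z + of_real pi"] assms(2)[of z]
    by (simp add: DERIV_shift)
  hence "\<exists>c. \<forall>z\<in>UNIV. F (z + of_real pi) - F z = c"
    by (intro has_field_derivative_zero_constant) auto
  thus ?thesis using F(2) by auto
qed

lemma period_integral_translate:
  assumes "f holomorphic_on UNIV"
  shows "period_integral p (\<lambda>z. f (z + c)) = period_integral (p + c) f"
proof -
  obtain F where F: "\<And>z. (F has_field_derivative f z) (at z)"
    "\<And>p. period_integral p f = F (p + of_real pi) - F p"
    using entire_primitive[OF assms(1)] by blast
  have "((\<lambda>z. F (z + c)) has_field_derivative f (z + c)) (at z within UNIV)" for z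
    using F(1)[of "z + c"] by (simp add: DERIV_shift)
  hence "((\<lambda>z. f (z + c)) has_contour_integral (F (p + of_real pi + c) - F (p + c))) (linepath p (p + of_real pi))"
    using contour_integral_primitive[of UNIV "\<lambda>z. F (z + c)" "\<lambda>z. f (z + c)" "linepath p (p + of_real pi)"] by auto
  thus ?thesis
    unfolding F(2) unfolding period_integral_def by (auto dest!: contour_integral_unique simp: add_ac)
qed

lemma entire_contour_integrable:
  "f holomorphic_on UNIV \<Longrightarrow> f contour_integrable_on linepath p q"
  by (intro contour_integrable_continuous_linepath holomorphic_on_imp_continuous_on)
     (auto elim: holomorphic_on_subset)

lemma period_integral_add:
  "f holomorphic_on UNIV \<Longrightarrow> g holomorphic_on UNIV \<Longrightarrow>
     period_integral p (\<lambda>z. f z + g z) = period_integral p f + period_integral p g"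
  unfolding period_integral_def by (intro contour_integral_add entire_contour_integrable)

lemma period_integral_diff:
  "f holomorphic_on UNIV \<Longrightarrow> g holomorphic_on UNIV \<Longrightarrow>
     period_integral p (\<lambda>z. f z - g z) = period_integral p f - period_integral p g"
  unfolding period_integral_def by (intro contour_integral_diff entire_contour_integrable)

lemma period_integral_cmult:
  "f holomorphic_on UNIV \<Longrightarrow> period_integral p (\<lambda>z. c * f z) = c * period_integral p f"
  unfolding period_integral_def by (intro contour_integral_lmul entire_contour_integrable)

lemma exp_2_i_int_pi: "exp (2 * \<i> * of_int k * (z + of_real pi)) = exp (2 * \<i> * of_int k * z)"
proof -
  have "exp (2 * \<i> * of_int k * (z + of_real pi)) = exp (2 * \<i> * of_int k * z) * exp (of_int k * (2 * of_real pi * \<i>))"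
    by (simp add: exp_add [symmetric] algebra_simps)
  also have "exp (of_int k * (2 * of_real pi * \<i>)) = 1"
    using exp_integer_2pi[of "of_int k"] by (simp add: mult_ac)
  finally show ?thesis by simp
qed

lemma period_integral_exp:
  "period_integral p (\<lambda>z. exp (2 * \<i> * of_int k * z)) = (if k = 0 then of_real pi else 0)"
proof (cases "k = 0")
  case True
  thus ?thesis by (simp add: period_integral_def)
next
  case False
  define F where "F z = exp (2 * \<i> * of_int k * z) / (2 * \<i> * of_int k)" for z
  have "(F has_field_derivative exp (2 * \<i> * of_int k * z)) (at z within UNIV)" for z
    unfolding F_def using False by (auto intro!: derivative_eq_intros)
  hence "((\<lambda>z. exp (2 * \<i> * of_int k * z)) has_contour_integral (F (p + of_real pi) - F p)) (linepath p (p + of_real pi))"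
    using contour_integral_primitive[of UNIV F "\<lambda>z. exp (2 * \<i> * of_int k * z)" "linepath p (p + of_real pi)"] by auto
  moreover have "F (p + of_real pi) = F p"
    by (simp only: F_def exp_2_i_int_pi)
  ultimately show ?thesis
    using False by (simp add: period_integral_def contour_integral_unique)
qed

text \<open>The normalising factor 1 / pi is omitted, since only vanishing and linear relations
  matter. The exponent 2 i k corresponds to the period pi.\<close>

definition fourier_coeff :: "(complex \<Rightarrow> complex) \<Rightarrow> int \<Rightarrow> complex" where
  "fourier_coeff f k = period_integral 0 (\<lambda>z. f z * exp (2 * \<i> * of_int (-k) * z))"

lemma fourier_coeff_eq:
  assumes "f holomorphic_on UNIV" "\<And>z. f (z + of_real pi) = f z"
  shows "fourier_coeff f k = period_integral p (\<lambda>z. f z * exp (2 * \<i> * of_int (-k) * z))"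
  unfolding fourier_coeff_def
proof (rule period_integral_indep)
  show "(\<lambda>z. f z * exp (2 * \<i> * of_int (-k) * z)) holomorphic_on UNIV"
    by (intro holomorphic_intros assms)
qed (simp only: assms(2) exp_2_i_int_pi)

lemma fourier_coeff_lincomb:
  assumes "f holomorphic_on UNIV" "g holomorphic_on UNIV"
  shows "fourier_coeff (\<lambda>z. x * f z + y * g z) k = x * fourier_coeff f k + y * fourier_coeff g k"
proof -
  have "fourier_coeff (\<lambda>z. x * f z + y * g z) k =
          period_integral 0 (\<lambda>z. x * (f z * exp (2 * \<i> * of_int (-k) * z)) + y * (g z * exp (2 * \<i> * of_int (-k) * z)))"
    by (simp add: fourier_coeff_def algebra_simps)
  thus ?thesis
    using assms by (simp add: fourier_coeff_def period_integral_add period_integral_cmult holomorphic_intros)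
qed

lemma periodic_of_int:
  assumes "\<And>z. f (z + of_real pi) = f z"
  shows "f (z + of_int n * of_real pi) = (f z :: complex)"
proof (induction n rule: int_induct[where k = 0])
  case (step1 i)
  thus ?case using assms[of "z + of_int i * of_real pi"] by (simp add: algebra_simps)
next
  case (step2 i)
  thus ?case using assms[of "z + of_int (i - 1) * of_real pi"] by (simp add: algebra_simps)
qed auto

text \<open>
  With \<open>E w = exp (2 \<i> (w - z))\<close>, the function \<open>f w - f z\<close> equals \<open>h w (1 - E w)\<close> for some entire \<open>h\<close>.
  The integrals of \<open>h E\<^sup>n\<close> over a period do not depend on the height of the path, so they tend to \<open>0\<close> as
  \<open>n\<close> tends to \<open>\<infinity>\<close> or \<open>-\<infinity>\<close>. Consecutive ones differ by Fourier coefficients of \<open>f w - f z\<close>, so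
  only the step at \<open>n = 0\<close> can be nonzero; it is \<open>- \<pi> f z\<close>.
\<close>

lemma fourier_coeffs_0_imp_0:
  assumes hol: "f holomorphic_on UNIV" and per: "\<And>z. f (z + of_real pi) = f z"
    and coeff: "\<And>k. fourier_coeff f k = 0"
  shows "f z = 0"
proof -
  \<comment> \<open>All zeros of \<open>B\<close> are translates of \<open>z\<close> by multiples of
    pi, where \<open>f\<close> takes the value \<open>f z\<close>; they are simple because the
    derivative is an exponential. So \<open>f w - f z\<close> is divisible by
    \<open>B\<close>.\<close>
  define B where "B w = 1 - exp (2 * \<i> * (w - z))" for w
  have B_hol: "B holomorphic_on UNIV"
    unfolding B_def [abs_def] by (intro holomorphic_intros)
  have B_deriv: "deriv B w = - 2 * \<i> * exp (2 * \<i> * (w - z))" for w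
    unfolding B_def [abs_def] by (rule DERIV_imp_deriv) (auto intro!: derivative_eq_intros)
  have B0: "f w - f z = 0" if w: "B w = 0" for w
  proof -
    have "exp (2 * \<i> * (w - z)) = 1"
      using w by (simp add: B_def)
    then obtain n :: int where "Re (2 * \<i> * (w - z)) = 0" "Im (2 * \<i> * (w - z)) = of_int (2 * n) * pi"
      unfolding exp_eq_1 by blast
    hence "2 * \<i> * (w - z) = of_int (2 * n) * of_real pi * \<i>"
      by (simp add: complex_eq_iff)
    hence "\<i> * (2 * (w - (z + of_int n * of_real pi))) = 0"
      by (simp add: algebra_simps)
    hence "w = z + of_int n * of_real pi" by (simp only: mult_eq_0_iff) auto
    thus ?thesis using periodic_of_int[of f z n] per by simp
  qed
  have "(\<lambda>w. f w - f z) holomorphic_on UNIV"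
    by (intro holomorphic_intros hol)
  then obtain h where h_hol: "h holomorphic_on UNIV" and h: "\<And>w. f w - f z = h w * B w"
    by (rule holomorphic_quotient_simple_zeros[of "\<lambda>w. f w - f z" B]) (auto simp: B_hol B_deriv B0)
  have B_per: "B (w + of_real pi) = B w" for w
    using exp_2_i_int_pi[of 1 "w - z"] by (simp add: B_def algebra_simps)
  \<comment> \<open>Both sides agree after multiplication by \<open>B\<close>, which is not
    identically zero: at \<open>z + \<i>\<close> the exponential has modulus exp(-2).\<close>
  have h_per: "h (w + of_real pi) = h w" for w
  proof (rule entire_eqI[of "\<lambda>w. h (w + of_real pi)" h B "z + \<i>"])
    show "(\<lambda>w. h (w + of_real pi)) holomorphic_on UNIV"
      using entire_affine[OF h_hol, of 1] by simp
    show "h (w + of_real pi) * B w = h w * B w" for w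
      using h[of w] h[of "w + of_real pi"] by (metis B_per per)
    have "norm (exp (2 * \<i> * (z + \<i> - z))) \<noteq> 1"
      by simp
    thus "B (z + \<i>) \<noteq> 0"
      unfolding B_def by (metis norm_one right_minus_eq)
  qed (use h_hol B_hol in auto)
  define G where "G n w = h w * exp (2 * \<i> * of_int n * (w - z))" for n :: int and w
  have G_hol: "G n holomorphic_on UNIV" for n
    unfolding G_def [abs_def] by (intro holomorphic_intros h_hol)
  have G_per: "G n (w + of_real pi) = G n w" for n w
    using exp_2_i_int_pi[of n "w - z"] by (simp add: G_def h_per algebra_simps)
  define I where "I n = period_integral 0 (G n)" for n
  have I_eq: "I n = period_integral p (G n)" for n p
    unfolding I_def by (rule period_integral_indep) (auto simp: G_hol G_per)
  \<comment> \<open>The integrand is (f w - f z) times the n-th power of E. The part with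
    \<open>f w\<close> is a multiple of the coefficient of index -n, which is 0; the part with
    \<open>f z\<close> survives only for n = 0.\<close>
  have step: "I n - I (n + 1) = (if n = 0 then - of_real pi * f z else 0)" for n
  proof -
    have "I n - I (n + 1) = period_integral 0 (\<lambda>w. G n w - G (n + 1) w)"
      unfolding I_def by (subst period_integral_diff) (auto simp: G_hol)
    also have "(\<lambda>w. G n w - G (n + 1) w) =
        (\<lambda>w. exp (- 2 * \<i> * of_int n * z) * (f w * exp (2 * \<i> * of_int n * w)) -
             exp (- 2 * \<i> * of_int n * z) * f z * exp (2 * \<i> * of_int n * w))"
    proof
      fix w
      have "G n w - G (n + 1) w = h w * B w * exp (2 * \<i> * of_int n * (w - z))"
      proof -
        have "exp (2 * \<i> * of_int (n + 1) * (w - z)) = exp (2 * \<i> * (w - z)) * exp (2 * \<i> * of_int n * (w - z))"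
          by (simp add: exp_add [symmetric] algebra_simps)
        thus ?thesis
          by (simp only: G_def B_def) (simp add: left_diff_distrib right_diff_distrib)
      qed
      also have "h w * B w = f w - f z" using h[of w] by simp
      also have "exp (2 * \<i> * of_int n * (w - z)) = exp (- 2 * \<i> * of_int n * z) * exp (2 * \<i> * of_int n * w)"
        by (simp add: exp_add [symmetric] algebra_simps)
      finally show "G n w - G (n + 1) w = exp (- 2 * \<i> * of_int n * z) * (f w * exp (2 * \<i> * of_int n * w)) -
             exp (- 2 * \<i> * of_int n * z) * f z * exp (2 * \<i> * of_int n * w)"
        by (simp add: algebra_simps)
    qed
    also have "period_integral 0 \<dots> = exp (- 2 * \<i> * of_int n * z) * period_integral 0 (\<lambda>w. f w * exp (2 * \<i> * of_int n * w)) -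
        exp (- 2 * \<i> * of_int n * z) * f z * period_integral 0 (\<lambda>w. exp (2 * \<i> * of_int n * w))"
      by (subst period_integral_diff period_integral_cmult; (intro holomorphic_intros hol)?)+ (rule refl)
    also have "period_integral 0 (\<lambda>w. f w * exp (2 * \<i> * of_int n * w)) = 0"
      using coeff[of "-n"] by (simp add: fourier_coeff_def)
    finally show ?thesis
      by (simp add: period_integral_exp)
  qed
  have bound: "\<exists>M. \<forall>n. norm (I (s * int n)) \<le> M * exp (-2) ^ n" if s: "s = 1 \<or> s = -1" for s :: int
  proof -
    \<comment> \<open>The path is raised by one unit for positive indices and lowered by one for
      negative indices, so that in both cases the exponential has modulus exp(-2) to the power
      n.\<close>
    define p where "p = z + of_int s * \<i>"
    have "compact (h ` closed_segment p (p + of_real pi))"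
      by (intro compact_continuous_image holomorphic_on_imp_continuous_on holomorphic_on_subset[OF h_hol]) auto
    then obtain M where M: "\<And>w. w \<in> closed_segment p (p + of_real pi) \<Longrightarrow> norm (h w) \<le> M"
      by (meson compact_imp_bounded bounded_iff imageI)
    have M0: "M \<ge> 0" using order_trans[OF norm_ge_zero M[of p]] by simp
    have "norm (I (s * int n)) \<le> (M * exp (-2) ^ n) * norm (p + of_real pi - p)" for n
      unfolding I_eq[of _ p] period_integral_def
    proof (rule contour_integral_bound_linepath)
      show "G (s * int n) contour_integrable_on linepath p (p + of_real pi)"
        by (intro entire_contour_integrable G_hol)
      show "0 \<le> M * exp (-2) ^ n" using M0 by simp
      fix w assume w: "w \<in> closed_segment p (p + of_real pi)"
      have "Im (w - z) = of_int s"
        using w by (auto simp: in_segment p_def algebra_simps)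
      hence "norm (exp (2 * \<i> * of_int (s * int n) * (w - z))) = exp (of_nat n * (-2))"
        using s by auto
      also have "\<dots> = exp (-2) ^ n" by (rule exp_of_nat_mult)
      finally show "norm (G (s * int n) w) \<le> M * exp (-2) ^ n"
        unfolding G_def norm_mult using M[OF w] by (simp add: mult_right_mono)
    qed
    thus ?thesis by (intro exI[of _ "M * pi"]) (simp add: mult_ac)
  qed
  have lim: "(\<lambda>n. I (s * int n)) \<longlonglongrightarrow> 0" if "s = 1 \<or> s = -1" for s :: int
  proof -
    from bound[OF that] obtain M where M: "\<And>n. norm (I (s * int n)) \<le> M * exp (-2) ^ n" by blast
    have "(\<lambda>n. M * exp (-2) ^ n) \<longlonglongrightarrow> M * 0"
      by (intro tendsto_mult tendsto_const LIMSEQ_power_zero) simp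
    hence "(\<lambda>n. M * exp (-2) ^ n) \<longlonglongrightarrow> 0" by simp
    with M show ?thesis by (rule Lim_null_comparison[OF always_eventually[OF allI]])
  qed
  \<comment> \<open>The integrals are constant for indices at least 1 and constant for indices at
    most 0. Both constants equal their limit 0, which leaves no room for the jump in
    between.\<close>
  have "I (1 * int (Suc n)) = I 1" for n
  proof (induction n)
    case (Suc n)
    thus ?case using step[of "int (Suc n)"] by (simp add: add_ac)
  qed simp
  hence I1: "I 1 = 0"
    using LIMSEQ_unique[OF LIMSEQ_Suc[OF lim[of 1]], of "I 1"] by simp
  have "I (-1 * int n) = I 0" for n
  proof (induction n)
    case (Suc n)
    thus ?case using step[of "- int (Suc n)"] by simp
  qed simp
  hence I0: "I 0 = 0"
    using LIMSEQ_unique[OF lim[of "-1"], of "I 0"] by simp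
  show ?thesis
    using step[of 0] I0 I1 by simp
qed

text \<open>Theta functions of order two: the multiplier for \<open>pi * \<tau>\<close> is the
  square of that of \<open>theta1\<close>, and the sign under translation by pi has
  disappeared.\<close>

definition theta_space :: "complex \<Rightarrow> (complex \<Rightarrow> complex) set" where
  "theta_space \<tau> = {f. f holomorphic_on UNIV \<and> (\<forall>z. f (z + of_real pi) = f z) \<and>
     (\<forall>z. f (z + of_real pi * \<tau>) = exp (- 2 * \<i> * of_real pi * \<tau> - 4 * \<i> * z) * f z)}"

lemma theta_space_lincomb:
  assumes "f \<in> theta_space \<tau>" "g \<in> theta_space \<tau>"
  shows "(\<lambda>z. x * f z + y * g z) \<in> theta_space \<tau>"
  using assms unfolding theta_space_def mem_Collect_eq
  by (intro conjI allI holomorphic_intros) (auto simp: distrib_left mult.left_commute)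

text \<open>Moving the path by \<open>pi * \<tau>\<close> leaves the coefficient unchanged, while
  the factor exp(-4 i z) of the multiplier raises the index by 2.\<close>

lemma fourier_coeff_theta_space:
  assumes "f \<in> theta_space \<tau>"
  shows "fourier_coeff f k = exp (- 2 * \<i> * of_real pi * \<tau> * (1 + of_int k)) * fourier_coeff f (k + 2)"
proof -
  let ?e = "\<lambda>k z. exp (2 * \<i> * of_int (-k) * z)"
  have f: "f holomorphic_on UNIV" "\<And>z. f (z + of_real pi) = f z"
    "\<And>z. f (z + of_real pi * \<tau>) = exp (- 2 * \<i> * of_real pi * \<tau> - 4 * \<i> * z) * f z"
    using assms by (auto simp: theta_space_def)
  have "fourier_coeff f k = period_integral (0 + of_real pi * \<tau>) (\<lambda>z. f z * ?e k z)"
    by (rule fourier_coeff_eq[OF f(1,2)])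
  also have "\<dots> = period_integral 0 (\<lambda>z. f (z + of_real pi * \<tau>) * ?e k (z + of_real pi * \<tau>))"
    by (rule period_integral_translate[of "\<lambda>z. f z * ?e k z", symmetric]) (intro holomorphic_intros f)
  also have "(\<lambda>z. f (z + of_real pi * \<tau>) * ?e k (z + of_real pi * \<tau>)) =
             (\<lambda>z. exp (- 2 * \<i> * of_real pi * \<tau> * (1 + of_int k)) * (f z * ?e (k + 2) z))"
  proof
    fix z
    have *: "exp (- 2 * \<i> * of_real pi * \<tau> - 4 * \<i> * z) * ?e k (z + of_real pi * \<tau>) =
          exp (- 2 * \<i> * of_real pi * \<tau> * (1 + of_int k)) * ?e (k + 2) z"
      unfolding exp_add [symmetric] by (simp add: algebra_simps)
    thus "f (z + of_real pi * \<tau>) * ?e k (z + of_real pi * \<tau>) =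
             exp (- 2 * \<i> * of_real pi * \<tau> * (1 + of_int k)) * (f z * ?e (k + 2) z)"
      unfolding f(3) using arg_cong[OF *, of "\<lambda>x. f z * x"] by (simp only: mult_ac)
  qed
  also have "period_integral 0 \<dots> = exp (- 2 * \<i> * of_real pi * \<tau> * (1 + of_int k)) * fourier_coeff f (k + 2)"
    unfolding fourier_coeff_def
    by (rule period_integral_cmult[of "\<lambda>z. f z * ?e (k + 2) z"]) (intro holomorphic_intros f)
  finally show ?thesis .
qed

lemma theta_space_eq_0:
  assumes f: "f \<in> theta_space \<tau>" and c: "fourier_coeff f 0 = 0" "fourier_coeff f 1 = 0"
  shows "f z = 0"
proof (rule fourier_coeffs_0_imp_0[of f])
  have "fourier_coeff f k = 0 \<and> fourier_coeff f (k + 1) = 0" for k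
  proof (induction k rule: int_induct[where k = 0])
    case (step1 k)
    thus ?case using fourier_coeff_theta_space[OF f, of k] by (simp add: add_ac)
  next
    case (step2 k)
    thus ?case using fourier_coeff_theta_space[OF f, of "k - 1"] by (simp add: add_ac)
  qed (use c in auto)
  thus "fourier_coeff f k = 0" for k by blast
qed (use f in \<open>auto simp: theta_space_def\<close>)

text \<open>Cramer's rule for the coefficients of index 0 and 1, which determine an element of the
  space; \<open>d\<close> is the determinant.\<close>

lemma theta_space_span:
  assumes f: "f \<in> theta_space \<tau>" and g: "g \<in> theta_space \<tau>" and h: "h \<in> theta_space \<tau>"
    and indep: "\<forall>x y. (\<forall>z. x * f z + y * g z = 0) \<longrightarrow> x = 0 \<and> y = 0"
  shows "\<exists>x y. \<forall>z. h z = x * f z + y * g z"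
proof -
  note hol = f[unfolded theta_space_def, simplified, THEN conjunct1]
    g[unfolded theta_space_def, simplified, THEN conjunct1]
    h[unfolded theta_space_def, simplified, THEN conjunct1]
  let ?c = fourier_coeff
  define d where "d = ?c f 0 * ?c g 1 - ?c f 1 * ?c g 0"
  have vanish: "x * f z + y * g z = 0"
    if "x * ?c f 0 + y * ?c g 0 = 0" "x * ?c f 1 + y * ?c g 1 = 0" for x y z
    by (rule theta_space_eq_0[OF theta_space_lincomb[OF f g]])
       (use that in \<open>simp_all add: fourier_coeff_lincomb hol\<close>)
  have d: "d \<noteq> 0"
  proof
    assume "d = 0"
    \<comment> \<open>Each of these combinations has both coefficients zero when \<open>d\<close> =
      0. Independence then makes all four coefficients vanish, so that \<open>f\<close> itself would
      be zero.\<close>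
    hence "?c g 0 * f z + (- ?c f 0) * g z = 0" "?c g 1 * f z + (- ?c f 1) * g z = 0" for z
      by (intro vanish; simp add: d_def mult.commute)+
    with indep have "?c g 0 = 0 \<and> - ?c f 0 = 0" "?c g 1 = 0 \<and> - ?c f 1 = 0"
      by (blast, blast)
    hence "?c g 0 = 0" "?c f 0 = 0" "?c g 1 = 0" "?c f 1 = 0"
      by simp_all
    hence "1 * f z + 0 * g z = 0" for z
      by (intro vanish) auto
    with indep have "(1 :: complex) = 0" by blast
    thus False by simp
  qed
  define x where "x = (?c h 0 * ?c g 1 - ?c h 1 * ?c g 0) / d"
  define y where "y = (?c f 0 * ?c h 1 - ?c f 1 * ?c h 0) / d"
  have lc: "(\<lambda>z. x * f z + y * g z) \<in> theta_space \<tau>"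
    by (rule theta_space_lincomb[OF f g])
  have "1 * h z + (-1) * (x * f z + y * g z) = 0" for z
  proof (rule theta_space_eq_0[OF theta_space_lincomb[OF h lc]])
    have e: "?c (\<lambda>z. 1 * h z + (-1) * (x * f z + y * g z)) k = ?c h k - (x * ?c f k + y * ?c g k)" for k
      by (subst fourier_coeff_lincomb) (auto intro!: holomorphic_intros hol simp: fourier_coeff_lincomb hol)
    have "d * (x * ?c f k + y * ?c g k) =
            (?c h 0 * ?c g 1 - ?c h 1 * ?c g 0) * ?c f k + (?c f 0 * ?c h 1 - ?c f 1 * ?c h 0) * ?c g k" for k
      using d by (simp add: x_def y_def distrib_left)
    from this[of 0] this[of 1]
    have "d * (x * ?c f 0 + y * ?c g 0) = d * ?c h 0" "d * (x * ?c f 1 + y * ?c g 1) = d * ?c h 1"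
      by (simp_all add: d_def algebra_simps)
    hence "x * ?c f 0 + y * ?c g 0 = ?c h 0" "x * ?c f 1 + y * ?c g 1 = ?c h 1"
      using d by simp_all
    thus "?c (\<lambda>z. 1 * h z + (-1) * (x * f z + y * g z)) 0 = 0"
         "?c (\<lambda>z. 1 * h z + (-1) * (x * f z + y * g z)) 1 = 0"
      unfolding e by simp_all
  qed
  hence "\<forall>z. h z = x * f z + y * g z" by (simp add: algebra_simps)
  thus ?thesis by (intro exI)
qed

section \<open>The theta function\<close>

lemma period_integral_uniform_limit:
  assumes "uniform_limit (closed_segment p (p + of_real pi)) F f sequentially"
    and "\<And>n. F n holomorphic_on UNIV"
  shows "(\<lambda>n. period_integral p (F n)) \<longlonglongrightarrow> period_integral p f"
  unfolding period_integral_def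
proof (rule contour_integral_uniform_limit(2))
  show "\<forall>\<^sub>F n in sequentially. F n contour_integrable_on linepath p (p + of_real pi)"
    by (intro always_eventually allI entire_contour_integrable assms)
  show "uniform_limit (path_image (linepath p (p + of_real pi))) F f sequentially"
    using assms(1) by simp
  show "norm (vector_derivative (linepath p (p + of_real pi)) (at t)) \<le> pi" for t
    by simp
qed auto

context
  fixes \<tau> :: complex
  assumes \<tau>: "Im \<tau> > 0"
begin

definition theta_coeff :: "nat \<Rightarrow> complex" where
  "theta_coeff n = (-1) ^ n * nome_power \<tau> ((of_nat n + 1 / 2)\<^sup>2)"

lemma theta_coeff_0: "theta_coeff 0 \<noteq> 0"
  by (simp add: theta_coeff_def nome_power_def)

text \<open>The positive-frequency half of the sine series; \<open>theta1\<close> is, up to the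
  factor -i, its difference with its reflection. A single exponential series makes the effect of a
  shift by \<open>pi * \<tau>\<close> on the terms visible.\<close>

definition half_theta :: "complex \<Rightarrow> complex" where
  "half_theta z = (\<Sum>n. theta_coeff n * exp (\<i> * (2 * of_nat n + 1) * z))"

lemma norm_theta_coeff: "norm (theta_coeff n) = exp (- pi * Im \<tau> * (real n + 1 / 2)\<^sup>2)"
proof -
  have "(of_nat n + 1 / 2 :: complex)\<^sup>2 = of_real ((real n + 1 / 2)\<^sup>2)"
    by simp
  thus ?thesis
    unfolding theta_coeff_def nome_power_def by (simp add: norm_mult norm_power del: of_real_power)
qed

text \<open>Ratio test: since (n + 3/2)^2 - (n + 1/2)^2 = 2n + 2, consecutive terms have ratio exp(2
  R - 2 pi Im(tau) (n + 1)). \<open>N\<close> is chosen to make this at most exp(-2).\<close>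

lemma summable_majorant: "summable (\<lambda>n. norm (theta_coeff n) * exp ((2 * real n + 1) * R))"
proof -
  obtain N :: nat where N: "real N > (R + 1) / (pi * Im \<tau>)"
    using reals_Archimedean2 by blast
  show ?thesis
  proof (rule summable_ratio_test[of "exp (-2)" N])
    fix n assume n: "n \<ge> N"
    have "(R + 1) / (pi * Im \<tau>) < real n + 1"
      using N n by linarith
    hence *: "R + 1 \<le> pi * Im \<tau> * (real n + 1)"
      using \<tau> by (simp add: field_simps)
    have "norm (norm (theta_coeff (Suc n)) * exp ((2 * real (Suc n) + 1) * R)) =
          exp (- pi * Im \<tau> * (real (Suc n) + 1 / 2)\<^sup>2 + (2 * real (Suc n) + 1) * R)"
      by (simp only: norm_theta_coeff mult_exp_exp real_norm_def abs_exp_cancel)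
    also have "\<dots> \<le> exp (-2 + (- pi * Im \<tau> * (real n + 1 / 2)\<^sup>2 + (2 * real n + 1) * R))"
      using * by (simp add: power2_eq_square algebra_simps)
    also have "\<dots> = exp (-2) * norm (norm (theta_coeff n) * exp ((2 * real n + 1) * R))"
      by (simp only: norm_theta_coeff mult_exp_exp real_norm_def abs_exp_cancel)
    finally show "norm (norm (theta_coeff (Suc n)) * exp ((2 * real (Suc n) + 1) * R)) \<le>
                  exp (-2) * norm (norm (theta_coeff n) * exp ((2 * real n + 1) * R))" .
  qed simp
qed

lemma half_theta_term_bound:
  assumes "norm z \<le> R"
  shows "norm (theta_coeff n * exp (\<i> * (2 * of_nat n + 1) * z)) \<le> norm (theta_coeff n) * exp ((2 * real n + 1) * R)"
proof -
  have "norm (exp (\<i> * (2 * of_nat n + 1) * z)) \<le> exp (norm (\<i> * (2 * of_nat n + 1) * z))"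
    by (rule norm_exp)
  also have "norm (\<i> * (2 * of_nat n + 1) * z) = (2 * real n + 1) * norm z"
  proof -
    have "norm (2 * of_nat n + 1 :: complex) = 2 * real n + 1"
      using norm_of_nat[of "2 * n + 1", where 'a = complex] by (simp add: add_ac)
    thus ?thesis by (simp add: norm_mult)
  qed
  also have "exp ((2 * real n + 1) * norm z) \<le> exp ((2 * real n + 1) * R)"
    using assms by (simp add: mult_left_mono)
  finally show ?thesis by (simp add: norm_mult mult_left_mono)
qed

lemma half_theta_uniform_limit:
  "uniform_limit (cball 0 R) (\<lambda>N z. \<Sum>n<N. theta_coeff n * exp (\<i> * (2 * of_nat n + 1) * z)) half_theta sequentially"
  unfolding half_theta_def [abs_def]
  by (rule Weierstrass_m_test[OF _ summable_majorant[of R]]) (auto intro: half_theta_term_bound)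

lemma half_theta_sums: "(\<lambda>n. theta_coeff n * exp (\<i> * (2 * of_nat n + 1) * z)) sums half_theta z"
  using tendsto_uniform_limitI[OF half_theta_uniform_limit[of "norm z"], of z] by (simp add: sums_def)

lemma half_theta_holomorphic: "half_theta holomorphic_on UNIV"
proof (rule holomorphic_uniform_sequence)
  fix z :: complex
  show "\<exists>d>0. cball z d \<subseteq> UNIV \<and> uniform_limit (cball z d)
          (\<lambda>N z. \<Sum>n<N. theta_coeff n * exp (\<i> * (2 * of_nat n + 1) * z)) half_theta sequentially"
  proof (intro exI[of _ 1] conjI)
    show "uniform_limit (cball z 1)
          (\<lambda>N z. \<Sum>n<N. theta_coeff n * exp (\<i> * (2 * of_nat n + 1) * z)) half_theta sequentially"
      by (rule uniform_limit_on_subset[OF half_theta_uniform_limit[of "norm z + 1"]])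
         (simp add: cball_subset_cball_iff)
  qed auto
qed (auto intro!: holomorphic_intros)

lemma theta1_eq: "theta1 z \<tau> = - \<i> * (half_theta z - half_theta (-z))"
proof -
  have "(\<lambda>n. (- \<i> / 2) * (theta_coeff n * exp (\<i> * (2 * of_nat n + 1) * z) - theta_coeff n * exp (\<i> * (2 * of_nat n + 1) * (-z))))
          sums ((- \<i> / 2) * (half_theta z - half_theta (-z)))"
    by (intro sums_mult sums_diff half_theta_sums)
  also have "(\<lambda>n. (- \<i> / 2) * (theta_coeff n * exp (\<i> * (2 * of_nat n + 1) * z) - theta_coeff n * exp (\<i> * (2 * of_nat n + 1) * (-z)))) =
             (\<lambda>n. (-1) ^ n * nome_power \<tau> ((of_nat n + 1 / 2)\<^sup>2) * sin ((2 * of_nat n + 1) * z))"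
  proof
    fix n
    have "(- \<i> / 2) * (exp (\<i> * w) - exp (- (\<i> * w))) = sin w" for w :: complex
      by (simp add: sin_exp_eq field_simps)
    note sin = this[of "(2 * of_nat n + 1) * z", symmetric]
    have arg: "\<i> * (2 * of_nat n + 1) * z = \<i> * ((2 * of_nat n + 1) * z)"
      "\<i> * (2 * of_nat n + 1) * (-z) = - (\<i> * ((2 * of_nat n + 1) * z))"
      by simp_all
    show "(- \<i> / 2) * (theta_coeff n * exp (\<i> * (2 * of_nat n + 1) * z) - theta_coeff n * exp (\<i> * (2 * of_nat n + 1) * (-z))) =
          (-1) ^ n * nome_power \<tau> ((of_nat n + 1 / 2)\<^sup>2) * sin ((2 * of_nat n + 1) * z)"
      unfolding arg sin theta_coeff_def by (simp only: right_diff_distrib mult_ac)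
  qed
  finally show ?thesis
    by (simp add: theta1_def sums_iff)
qed

section \<open>Oddness, quasi-periodicity and nontriviality of theta\<close>

lemma theta1_holomorphic: "(\<lambda>z. theta1 z \<tau>) holomorphic_on UNIV"
  unfolding theta1_eq using entire_affine[OF half_theta_holomorphic, of "-1" 0]
  by (auto intro!: holomorphic_intros half_theta_holomorphic)

lemma theta1_uminus: "theta1 (-z) \<tau> = - theta1 z \<tau>"
  by (simp add: theta1_eq algebra_simps)

lemma half_theta_add_pi: "half_theta (z + of_real pi) = - half_theta z"
proof -
  have "exp (\<i> * (2 * of_nat n + 1) * (z + of_real pi)) = - exp (\<i> * (2 * of_nat n + 1) * z)" for n :: nat
  proof -
    have "\<i> * (2 * of_nat n + 1) * (z + of_real pi) =
            \<i> * (2 * of_nat n + 1) * z + (of_int (int n) * (2 * of_real pi * \<i>) + of_real pi * \<i>)"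
      by (simp add: algebra_simps)
    also have "exp \<dots> = exp (\<i> * (2 * of_nat n + 1) * z) * (exp (of_int (int n) * (2 * of_real pi * \<i>)) * exp (of_real pi * \<i>))"
      by (simp only: exp_add)
    also have "exp (of_int (int n) * (2 * of_real pi * \<i>)) = 1"
      using exp_integer_2pi[of "of_int (int n)"] by (simp add: mult_ac)
    finally show ?thesis by simp
  qed
  hence "(\<lambda>n. - (theta_coeff n * exp (\<i> * (2 * of_nat n + 1) * z))) sums half_theta (z + of_real pi)"
    using half_theta_sums[of "z + of_real pi"] by simp
  moreover have "(\<lambda>n. - (theta_coeff n * exp (\<i> * (2 * of_nat n + 1) * z))) sums - half_theta z"
    by (intro sums_minus half_theta_sums)
  ultimately show ?thesis by (rule sums_unique2)
qed

lemma theta1_add_pi: "theta1 (z + of_real pi) \<tau> = - theta1 z \<tau>"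
  using half_theta_add_pi[of z] half_theta_add_pi[of "-z - of_real pi"]
  by (simp add: theta1_eq algebra_simps)

lemma theta_coeff_Suc: "theta_coeff (Suc n) = - nome_power \<tau> (2 * of_nat n + 2) * theta_coeff n"
  unfolding theta_coeff_def nome_power_def power_Suc
  by (simp add: exp_add [symmetric] power2_eq_square algebra_simps add_divide_distrib)

text \<open>The shift turns the term of index n into a fixed multiple of the term of index n + 1, so
  the term of index 0 is lost.\<close>

lemma half_theta_add_pi_tau:
  "half_theta (z + of_real pi * \<tau>) =
     - exp (- \<i> * of_real pi * \<tau> - 2 * \<i> * z) * (half_theta z - theta_coeff 0 * exp (\<i> * z))"
proof -
  let ?k = "- exp (- \<i> * of_real pi * \<tau> - 2 * \<i> * z)"
  have "theta_coeff n * exp (\<i> * (2 * of_nat n + 1) * (z + of_real pi * \<tau>)) =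
        ?k * (theta_coeff (Suc n) * exp (\<i> * (2 * of_nat (Suc n) + 1) * z))" for n
    unfolding theta_coeff_Suc nome_power_def
    by (simp add: mult.left_commute[of _ "theta_coeff n"] exp_add [symmetric] algebra_simps)
  hence "(\<lambda>n. ?k * (theta_coeff (Suc n) * exp (\<i> * (2 * of_nat (Suc n) + 1) * z))) sums half_theta (z + of_real pi * \<tau>)"
    using half_theta_sums[of "z + of_real pi * \<tau>"] by simp
  moreover have "(\<lambda>n. theta_coeff (Suc n) * exp (\<i> * (2 * of_nat (Suc n) + 1) * z)) sums (half_theta z - theta_coeff 0 * exp (\<i> * z))"
    using half_theta_sums[of z] by (subst sums_Suc_iff) simp
  hence "(\<lambda>n. ?k * (theta_coeff (Suc n) * exp (\<i> * (2 * of_nat (Suc n) + 1) * z))) sums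
           (?k * (half_theta z - theta_coeff 0 * exp (\<i> * z)))"
    by (rule sums_mult)
  ultimately show ?thesis by (rule sums_unique2)
qed

text \<open>For the reflected half the previous relation is used backwards, at the point
  \<open>?w\<close> with \<open>?w + pi * \<tau>\<close> = -z. Both halves then carry the same
  defect \<open>theta_coeff 0 * exp (\<i> * z)\<close>, which cancels in their difference.\<close>

lemma theta1_add_pi_tau:
  "theta1 (z + of_real pi * \<tau>) \<tau> = - exp (- \<i> * of_real pi * \<tau> - 2 * \<i> * z) * theta1 z \<tau>"
proof -
  let ?k = "- exp (- \<i> * of_real pi * \<tau> - 2 * \<i> * z)" and ?w = "-z - of_real pi * \<tau>"
  have "half_theta (-z) = - exp (- \<i> * of_real pi * \<tau> - 2 * \<i> * ?w) * (half_theta ?w - theta_coeff 0 * exp (\<i> * ?w))"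
    using half_theta_add_pi_tau[of ?w] by simp
  hence "?k * half_theta (-z) = (exp (- \<i> * of_real pi * \<tau> - 2 * \<i> * z) * exp (- \<i> * of_real pi * \<tau> - 2 * \<i> * ?w)) *
            (half_theta ?w - theta_coeff 0 * exp (\<i> * ?w))"
    by simp
  also have "exp (- \<i> * of_real pi * \<tau> - 2 * \<i> * z) * exp (- \<i> * of_real pi * \<tau> - 2 * \<i> * ?w) = 1"
    unfolding exp_add [symmetric] by (simp add: algebra_simps)
  also have "theta_coeff 0 * exp (\<i> * ?w) = - ?k * (theta_coeff 0 * exp (\<i> * z))"
    by (simp add: mult.left_commute[of _ "theta_coeff 0"] exp_add [symmetric] algebra_simps)
  finally have hw: "half_theta ?w = ?k * (half_theta (-z) - theta_coeff 0 * exp (\<i> * z))"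
    by (simp add: algebra_simps)
  have w: "- (z + of_real pi * \<tau>) = ?w" by simp
  have "theta1 (z + of_real pi * \<tau>) \<tau> =
           - \<i> * (?k * (half_theta z - theta_coeff 0 * exp (\<i> * z)) - ?k * (half_theta (-z) - theta_coeff 0 * exp (\<i> * z)))"
    by (simp only: theta1_eq w hw half_theta_add_pi_tau)
  also have "- \<i> * (k * (a - x) - k * (b - x)) = k * (- \<i> * (a - b))" for k a b x :: complex
    by (simp add: algebra_simps)
  finally show ?thesis by (simp only: theta1_eq)
qed

lemma theta1_0: "theta1 0 \<tau> = 0"
  using theta1_uminus[of 0] by simp

text \<open>If theta vanished identically, \<open>half_theta\<close> would be even. But the period
  integral of \<open>half_theta z * exp (- \<i> * z)\<close> is pi times the leading coefficient,
  and after replacing z by -z in \<open>half_theta\<close> it is 0.\<close>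

lemma theta1_not_identically_0: "\<exists>z. theta1 z \<tau> \<noteq> 0"
proof (rule ccontr)
  assume "\<not> (\<exists>z. theta1 z \<tau> \<noteq> 0)"
  hence eq: "half_theta z = half_theta (-z)" for z
    by (auto simp: theta1_eq)
  let ?S = "closed_segment 0 (0 + of_real pi :: complex)"
  have sub: "?S \<subseteq> cball 0 pi" "uminus ` ?S \<subseteq> cball 0 pi"
    by (auto simp: in_segment)
  have bdd: "bounded ((\<lambda>z. exp (- \<i> * z)) ` ?S)"
    by (intro compact_imp_bounded compact_continuous_image continuous_intros) auto
  have int: "period_integral 0 (\<lambda>z. \<Sum>n<N. theta_coeff n * exp (2 * \<i> * of_int (k n) * z)) =
          (\<Sum>n<N. theta_coeff n * (if k n = 0 then of_real pi else 0))" for N and k :: "nat \<Rightarrow> int"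
  proof (induction N)
    case (Suc N)
    have "period_integral 0 (\<lambda>z. \<Sum>n<Suc N. theta_coeff n * exp (2 * \<i> * of_int (k n) * z)) =
          period_integral 0 (\<lambda>z. \<Sum>n<N. theta_coeff n * exp (2 * \<i> * of_int (k n) * z)) +
          period_integral 0 (\<lambda>z. theta_coeff N * exp (2 * \<i> * of_int (k N) * z))"
      unfolding sum.lessThan_Suc by (rule period_integral_add) (intro holomorphic_intros)+
    also have "period_integral 0 (\<lambda>z. theta_coeff N * exp (2 * \<i> * of_int (k N) * z)) =
          theta_coeff N * (if k N = 0 then of_real pi else 0)"
      by (subst period_integral_cmult) (intro holomorphic_intros, simp only: period_integral_exp)
    finally show ?case by (simp only: Suc.IH sum.lessThan_Suc)
  qed (simp add: period_integral_def)
  \<comment> \<open>Termwise integration by uniform convergence, for c = 1 and c = -1. The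
    frequencies are k n = n, which is 0 once, and k n = -n - 1, which is never 0.\<close>
  have lim: "(\<lambda>N. \<Sum>n<N. theta_coeff n * (if k n = 0 then of_real pi else 0)) \<longlonglongrightarrow>
               period_integral 0 (\<lambda>z. half_theta (c * z) * exp (- \<i> * z))"
    if k: "\<And>n z. exp (2 * \<i> * of_int (k n) * z) = exp (\<i> * (2 * of_nat n + 1) * (c * z)) * exp (- \<i> * z)"
      and c: "norm c = 1" for k c
  proof -
    have "uniform_limit ?S (\<lambda>N z. \<Sum>n<N. theta_coeff n * exp (\<i> * (2 * of_nat n + 1) * (c * z))) (\<lambda>z. half_theta (c * z)) sequentially"
      by (rule uniform_limit_compose'[OF half_theta_uniform_limit[of pi]])
         (auto simp: in_segment norm_mult c)
    hence "uniform_limit ?S (\<lambda>N z. (\<Sum>n<N. theta_coeff n * exp (\<i> * (2 * of_nat n + 1) * (c * z))) * exp (- \<i> * z))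
             (\<lambda>z. half_theta (c * z) * exp (- \<i> * z)) sequentially"
    proof (rule uniform_lim_mult[OF _ uniform_limit_const _ bdd])
      show "bounded ((\<lambda>z. half_theta (c * z)) ` ?S)"
        using entire_affine[OF half_theta_holomorphic, of c 0]
        by (intro compact_imp_bounded compact_continuous_image holomorphic_on_imp_continuous_on)
           (auto elim: holomorphic_on_subset)
    qed
    also have "(\<lambda>N z. (\<Sum>n<N. theta_coeff n * exp (\<i> * (2 * of_nat n + 1) * (c * z))) * exp (- \<i> * z)) =
               (\<lambda>N z. \<Sum>n<N. theta_coeff n * exp (2 * \<i> * of_int (k n) * z))"
      unfolding k by (simp only: sum_distrib_right mult.assoc)
    finally have ul: "uniform_limit ?S (\<lambda>N z. \<Sum>n<N. theta_coeff n * exp (2 * \<i> * of_int (k n) * z))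
        (\<lambda>z. half_theta (c * z) * exp (- \<i> * z)) sequentially" .
    have "(\<lambda>z. \<Sum>n<N. theta_coeff n * exp (2 * \<i> * of_int (k n) * z)) holomorphic_on UNIV" for N
      by (intro holomorphic_intros)
    from period_integral_uniform_limit[OF ul this] show ?thesis
      unfolding int .
  qed
  have "(\<lambda>N. \<Sum>n<N. theta_coeff n * (if int n = 0 then of_real pi else 0)) \<longlonglongrightarrow>
               period_integral 0 (\<lambda>z. half_theta (1 * z) * exp (- \<i> * z))"
    by (rule lim) (simp_all add: exp_add [symmetric] algebra_simps)
  moreover have "(\<lambda>N. \<Sum>n<N. theta_coeff n * (if int n = 0 then of_real pi else 0)) \<longlonglongrightarrow> theta_coeff 0 * of_real pi"
    using sums_single[of 0 "\<lambda>n. theta_coeff n * of_real pi"] by (simp add: sums_def if_distrib cong: if_cong)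
  ultimately have 1: "period_integral 0 (\<lambda>z. half_theta (1 * z) * exp (- \<i> * z)) = theta_coeff 0 * of_real pi"
    by (rule LIMSEQ_unique)
  have "(\<lambda>N. \<Sum>n<N. theta_coeff n * (if - int n - 1 = 0 then of_real pi else 0)) \<longlonglongrightarrow>
               period_integral 0 (\<lambda>z. half_theta ((-1) * z) * exp (- \<i> * z))"
  proof (rule lim)
    show "exp (2 * \<i> * of_int (- int n - 1) * z) = exp (\<i> * (2 * of_nat n + 1) * ((-1) * z)) * exp (- \<i> * z)"
      for n :: nat and z :: complex
      unfolding exp_add [symmetric] by (rule arg_cong[of _ _ exp]) (simp add: algebra_simps)
  qed simp
  moreover have "(if - int n - 1 = 0 then of_real pi else 0) = (0 :: complex)" for n
    by auto
  ultimately have 2: "period_integral 0 (\<lambda>z. half_theta ((-1) * z) * exp (- \<i> * z)) = 0"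
    using LIMSEQ_unique[OF tendsto_const] by fastforce
  have "(\<lambda>z. half_theta (1 * z) * exp (- \<i> * z)) = (\<lambda>z. half_theta ((-1) * z) * exp (- \<i> * z))"
    using eq by auto
  with 1 2 theta_coeff_0 show False by simp
qed

end

section \<open>The Weierstrass function as a quotient of theta functions\<close>

lemma of_int_mult_shift_iff:
  fixes d :: complex
  assumes "\<And>z. P (z + d) \<longleftrightarrow> P z"
  shows "P (z + of_int n * d) \<longleftrightarrow> P z"
proof (induction n rule: int_induct[where k = 0])
  case (step1 i)
  thus ?case using assms[of "z + of_int i * d"] by (simp add: algebra_simps)
next
  case (step2 i)
  thus ?case using assms[of "z + of_int (i - 1) * d"] by (simp add: algebra_simps)
qed auto

text \<open>The factor is the sign of the parity of \<open>n\<close>; only that its square is 1 will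
  matter.\<close>

lemma antiperiodic_of_int:
  fixes f :: "complex \<Rightarrow> complex"
  assumes "\<And>z. f (z + d) = - f z"
  obtains \<epsilon> where "\<epsilon> * \<epsilon> = 1" "\<And>z. f (z + of_int n * d) = \<epsilon> * f z"
proof -
  have "\<exists>\<epsilon>. \<epsilon> * \<epsilon> = 1 \<and> (\<forall>z. f (z + of_int n * d) = \<epsilon> * f z)"
  proof (induction n rule: int_induct[where k = 0])
    case base
    show ?case by (intro exI[of _ 1]) auto
  next
    case (step1 i)
    then obtain \<epsilon> where e: "\<epsilon> * \<epsilon> = 1" "\<And>z. f (z + of_int i * d) = \<epsilon> * f z" by blast
    have "f (z + of_int (i + 1) * d) = - \<epsilon> * f z" for z
      using assms[of "z + of_int i * d"] e(2)[of z] by (simp add: algebra_simps)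
    thus ?case using e(1) by (intro exI[of _ "- \<epsilon>"]) auto
  next
    case (step2 i)
    then obtain \<epsilon> where e: "\<epsilon> * \<epsilon> = 1" "\<And>z. f (z + of_int i * d) = \<epsilon> * f z" by blast
    have "f (z + of_int (i - 1) * d) = - \<epsilon> * f z" for z
    proof -
      have "- f (z + of_int (i - 1) * d) = \<epsilon> * f z"
        using assms[of "z + of_int (i - 1) * d"] e(2)[of z] by (simp add: algebra_simps)
      thus ?thesis by (metis minus_minus mult_minus_left)
    qed
    thus ?case using e(1) by (intro exI[of _ "- \<epsilon>"]) auto
  qed
  thus ?thesis using that by blast
qed

context complex_lattice
begin

definition \<tau> :: complex where "\<tau> = \<omega>\<^sub>2 / \<omega>\<^sub>1"

definition scale :: complex where "scale = 2 * \<omega>\<^sub>1 / of_real pi"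

definition theta :: "complex \<Rightarrow> complex" where "theta v = theta1 v \<tau>"

lemma Im_tau: "Im \<tau> > 0"
  using Im_pos by (simp add: \<tau>_def)

lemma scale_nonzero: "scale \<noteq> 0"
  using \<omega>\<^sub>1_nonzero by (simp add: scale_def)

lemma scale_pi: "scale * (v + of_real pi) = scale * v + 2 * \<omega>\<^sub>1"
  by (simp add: scale_def distrib_left)

lemma scale_pi_tau: "scale * (v + of_real pi * \<tau>) = scale * v + 2 * \<omega>\<^sub>2"
  using \<omega>\<^sub>1_nonzero by (simp add: scale_def \<tau>_def distrib_left)

lemma theta_holomorphic: "theta holomorphic_on UNIV"
  unfolding theta_def [abs_def] by (rule theta1_holomorphic[OF Im_tau])

lemma theta_uminus: "theta (-v) = - theta v"
  unfolding theta_def by (rule theta1_uminus[OF Im_tau])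

lemma theta_0: "theta 0 = 0"
  unfolding theta_def by (rule theta1_0[OF Im_tau])

lemma theta_add_pi: "theta (v + of_real pi) = - theta v"
  unfolding theta_def by (rule theta1_add_pi[OF Im_tau])

lemma theta_add_pi_tau: "theta (v + of_real pi * \<tau>) = - exp (- \<i> * of_real pi * \<tau> - 2 * \<i> * v) * theta v"
  unfolding theta_def by (rule theta1_add_pi_tau[OF Im_tau])

lemma theta_nonzero: obtains v where "theta v \<noteq> 0"
  using theta1_not_identically_0[OF Im_tau] unfolding theta_def by blast

lemma scaled_in_lattice_iff: "scale * v \<in> \<Lambda> \<longleftrightarrow> (\<exists>m n :: int. v = of_int m * of_real pi + of_int n * (of_real pi * \<tau>))"
proof -
  have "scale * v = lattice_point (m, n) \<longleftrightarrow> v = of_int m * of_real pi + of_int n * (of_real pi * \<tau>)" for m n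
  proof -
    have "lattice_point (m, n) = scale * (of_int m * of_real pi + of_int n * (of_real pi * \<tau>))"
      using \<omega>\<^sub>1_nonzero by (simp add: lattice_point_def scale_def \<tau>_def distrib_left)
    thus ?thesis using scale_nonzero by simp
  qed
  thus ?thesis unfolding lattice_eq by auto
qed

lemma theta_eq_0_on_lattice:
  assumes "scale * v \<in> \<Lambda>"
  shows "theta v = 0"
proof -
  obtain m n :: int where v: "v = of_int m * of_real pi + of_int n * (of_real pi * \<tau>)"
    using assms scaled_in_lattice_iff by blast
  have "theta (0 + of_int m * of_real pi + of_int n * (of_real pi * \<tau>)) = 0 \<longleftrightarrow> theta (0 + of_int m * of_real pi) = 0"
    by (rule of_int_mult_shift_iff) (simp add: theta_add_pi_tau)
  also have "\<dots> \<longleftrightarrow> theta 0 = 0"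
    by (rule of_int_mult_shift_iff) (simp add: theta_add_pi)
  finally show ?thesis by (simp add: v theta_0)
qed

section \<open>Clearing the poles of the Weierstrass function\<close>

definition sigma_scaled :: "complex \<Rightarrow> complex" where "sigma_scaled v = \<sigma> (scale * v)"

lemma sigma_scaled_holomorphic: "sigma_scaled holomorphic_on UNIV"
  unfolding sigma_scaled_def [abs_def] using entire_affine[OF sigma_holomorphic, of scale 0] by simp

lemma sigma_scaled_eq_0_iff: "sigma_scaled v = 0 \<longleftrightarrow> scale * v \<in> \<Lambda>"
  by (simp add: sigma_scaled_def sigma_eq_0_iff)

lemma sigma_scaled_has_derivative: "(sigma_scaled has_field_derivative scale * deriv \<sigma> (scale * v)) (at v)"
proof -
  have "((\<lambda>v. \<sigma> (scale * v)) has_field_derivative deriv \<sigma> (scale * v) * scale) (at v)"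
    by (rule DERIV_chain2[where f = \<sigma> and g = "\<lambda>v. scale * v", OF sigma_deriv]) (auto intro!: derivative_eq_intros)
  thus ?thesis by (simp add: sigma_scaled_def [abs_def] mult.commute)
qed

text \<open>Multiplying by this quotient instead of by theta turns the poles of the Weierstrass function into removable ones.\<close>

definition theta_quotient :: "complex \<Rightarrow> complex" where
  "theta_quotient = (SOME theta_quotient. theta_quotient holomorphic_on UNIV \<and> (\<forall>v. theta v = theta_quotient v * sigma_scaled v))"

text \<open>Theta vanishes at every lattice point and sigma has simple zeros there, so the quotient
  is entire. That theta has no further zeros is not yet known here.\<close>

lemma theta_quotient_holomorphic: "theta_quotient holomorphic_on UNIV" and theta_eq: "theta v = theta_quotient v * sigma_scaled v"
proof -
  have dS: "deriv sigma_scaled v \<noteq> 0" if "sigma_scaled v = 0" for v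
    using that deriv_sigma_nonzero[of "scale * v"] scale_nonzero DERIV_imp_deriv[OF sigma_scaled_has_derivative, of v]
    by (simp add: sigma_scaled_def)
  obtain h where "h holomorphic_on UNIV" "\<And>v. theta v = h v * sigma_scaled v"
    by (rule holomorphic_quotient_simple_zeros[OF theta_holomorphic sigma_scaled_holomorphic])
       (auto simp: dS theta_eq_0_on_lattice sigma_scaled_eq_0_iff)
  hence "\<exists>theta_quotient. theta_quotient holomorphic_on UNIV \<and> (\<forall>v. theta v = theta_quotient v * sigma_scaled v)" by blast
  hence "theta_quotient holomorphic_on UNIV \<and> (\<forall>v. theta v = theta_quotient v * sigma_scaled v)"
    unfolding theta_quotient_def by (rule someI_ex)
  thus "theta_quotient holomorphic_on UNIV" "theta v = theta_quotient v * sigma_scaled v"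
    by blast+
qed

text \<open>The entire function \<open>wp\<close> times the square of sigma. Multiplied by the
  square of theta over sigma, it becomes the entire continuation \<open>wp_theta_square\<close> of
  \<open>wp\<close> times the square of theta.\<close>

definition wp_numerator :: "complex \<Rightarrow> complex" where
  "wp_numerator v = (deriv \<sigma> (scale * v))\<^sup>2 - \<sigma> (scale * v) * deriv (deriv \<sigma>) (scale * v)"

definition wp_theta_square :: "complex \<Rightarrow> complex" where "wp_theta_square v = wp_numerator v * (theta_quotient v)\<^sup>2"

lemma wp_numerator_holomorphic: "wp_numerator holomorphic_on UNIV"
proof -
  have "f holomorphic_on UNIV \<Longrightarrow> (\<lambda>v. f (scale * v)) holomorphic_on UNIV" for f
    using entire_affine[of f scale 0] by simp
  thus ?thesis
    unfolding wp_numerator_def [abs_def] by (intro holomorphic_intros) (auto intro!: holomorphic_deriv sigma_holomorphic)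
qed

lemma wp_theta_square_holomorphic: "wp_theta_square holomorphic_on UNIV"
  unfolding wp_theta_square_def [abs_def] by (intro holomorphic_intros wp_numerator_holomorphic theta_quotient_holomorphic)

lemma wp_theta_square_eq: "scale * v \<notin> \<Lambda> \<Longrightarrow> wp_theta_square v = wp (scale * v) * (theta v)\<^sup>2"
  using sigma_scaled_eq_0_iff[of v] by (simp add: wp_theta_square_def wp_numerator_def theta_eq wp_eq sigma_scaled_def power_mult_distrib)

lemma wp_numerator_0: "wp_numerator 0 = 1"
  using lattice_0 sigma_eq_0_iff[of 0] by (simp add: wp_numerator_def deriv_sigma_0)

text \<open>At 0 the double pole of \<open>wp\<close> meets the double zero of the square of theta.
  This value is the origin of the squared derivative and of the factor pi^2 / (4 omega_1^2) = 1 /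
  scale^2 in the constant \<open>C\<close>.\<close>

lemma deriv_theta_0: "(deriv theta 0)\<^sup>2 = scale\<^sup>2 * wp_theta_square 0"
proof -
  have S0: "sigma_scaled 0 = 0" using lattice_0 by (simp add: sigma_scaled_eq_0_iff)
  have "(theta_quotient has_field_derivative deriv theta_quotient 0) (at 0)"
    using theta_quotient_holomorphic by (auto intro: holomorphic_derivI)
  from DERIV_mult[OF this sigma_scaled_has_derivative[of 0]] have "((\<lambda>v. theta_quotient v * sigma_scaled v) has_field_derivative scale * theta_quotient 0) (at 0)"
    by (simp add: S0 deriv_sigma_0 mult.commute)
  hence "deriv theta 0 = scale * theta_quotient 0"
    by (intro DERIV_imp_deriv) (simp add: theta_eq [abs_def])
  thus ?thesis by (simp add: wp_theta_square_def wp_numerator_0 power_mult_distrib)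
qed

lemma not_lattice_point: obtains v0 where "sigma_scaled v0 \<noteq> 0"
proof -
  have "scale * (\<omega>\<^sub>1 / scale) = \<omega>\<^sub>1" using scale_nonzero by simp
  hence "sigma_scaled (\<omega>\<^sub>1 / scale) \<noteq> 0" using half_period_notin(2)[of \<omega>\<^sub>1] by (simp add: sigma_scaled_eq_0_iff)
  thus ?thesis by (rule that)
qed

lemma shift_in_lattice_iff: "scale * (v + of_real pi) \<in> \<Lambda> \<longleftrightarrow> scale * v \<in> \<Lambda>" "scale * (v + of_real pi * \<tau>) \<in> \<Lambda> \<longleftrightarrow> scale * v \<in> \<Lambda>"
proof -
  have "x + y \<in> \<Lambda> \<longleftrightarrow> x \<in> \<Lambda>" if "y \<in> \<Lambda>" for x y
    using that lattice_add[of x y] lattice_diff[of "x + y" y] by auto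
  thus "scale * (v + of_real pi) \<in> \<Lambda> \<longleftrightarrow> scale * v \<in> \<Lambda>" "scale * (v + of_real pi * \<tau>) \<in> \<Lambda> \<longleftrightarrow> scale * v \<in> \<Lambda>"
    unfolding scale_pi scale_pi_tau using half_period_notin(1) by auto
qed

lemma exp_square_eq: "(- exp (- \<i> * of_real pi * \<tau> - 2 * \<i> * v))\<^sup>2 = exp (- 2 * \<i> * of_real pi * \<tau> - 4 * \<i> * v)"
  unfolding power2_minus unfolding power2_eq_square exp_add [symmetric]
  by (rule arg_cong[of _ _ exp]) (simp add: algebra_simps)

lemma wp_theta_square_in_theta_space: "wp_theta_square \<in> theta_space \<tau>"
proof -
  have shift: "wp_theta_square (v + d) = e v * wp_theta_square v"
    if d: "\<And>v. scale * v \<notin> \<Lambda> \<Longrightarrow> scale * (v + d) \<notin> \<Lambda>" "\<And>v. scale * v \<notin> \<Lambda> \<Longrightarrow> wp (scale * (v + d)) = wp (scale * v)"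
      and e: "e holomorphic_on UNIV" "\<And>v. (theta (v + d))\<^sup>2 = e v * (theta v)\<^sup>2" for d e v
  proof -
    obtain v0 where v0: "sigma_scaled v0 \<noteq> 0" by (rule not_lattice_point)
    show ?thesis
    \<comment> \<open>Multiplying by \<open>sigma_scaled\<close> makes both sides vanish at lattice
      points; elsewhere the explicit product with \<open>wp\<close> is available.\<close>
    proof (rule entire_eqI[of "\<lambda>v. wp_theta_square (v + d)" "\<lambda>v. e v * wp_theta_square v" sigma_scaled])
      show "(\<lambda>v. wp_theta_square (v + d)) holomorphic_on UNIV"
        using entire_affine[OF wp_theta_square_holomorphic, of 1 d] by simp
      show "wp_theta_square (v + d) * sigma_scaled v = e v * wp_theta_square v * sigma_scaled v" for v
        by (cases "scale * v \<in> \<Lambda>") (auto simp: sigma_scaled_eq_0_iff[THEN iffD2] wp_theta_square_eq d e(2))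
    qed (use v0 in \<open>auto intro!: holomorphic_intros e wp_theta_square_holomorphic sigma_scaled_holomorphic\<close>)
  qed
  have "wp_theta_square (v + of_real pi) = 1 * wp_theta_square v" for v
  proof (rule shift)
    show "scale * v \<notin> \<Lambda> \<Longrightarrow> scale * (v + of_real pi) \<notin> \<Lambda>" for v
      by (simp add: shift_in_lattice_iff)
    show "scale * v \<notin> \<Lambda> \<Longrightarrow> wp (scale * (v + of_real pi)) = wp (scale * v)" for v
      by (simp add: scale_pi wp_add_period)
  qed (simp_all add: theta_add_pi)
  moreover have "wp_theta_square (v + of_real pi * \<tau>) = exp (- 2 * \<i> * of_real pi * \<tau> - 4 * \<i> * v) * wp_theta_square v" for v
  proof (rule shift)
    show "(\<lambda>v. exp (- 2 * \<i> * of_real pi * \<tau> - 4 * \<i> * v)) holomorphic_on UNIV"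
      by (intro holomorphic_intros)
    show "(theta (v + of_real pi * \<tau>))\<^sup>2 = exp (- 2 * \<i> * of_real pi * \<tau> - 4 * \<i> * v) * (theta v)\<^sup>2" for v
      by (simp only: theta_add_pi_tau power_mult_distrib exp_square_eq)
    show "scale * v \<notin> \<Lambda> \<Longrightarrow> scale * (v + of_real pi * \<tau>) \<notin> \<Lambda>" for v
      by (simp add: shift_in_lattice_iff)
    show "scale * v \<notin> \<Lambda> \<Longrightarrow> wp (scale * (v + of_real pi * \<tau>)) = wp (scale * v)" for v
      by (simp add: scale_pi_tau wp_add_period)
  qed
  ultimately show ?thesis
    using wp_theta_square_holomorphic by (simp add: theta_space_def)
qed

text \<open>The shifts by -b and b enter the two multipliers with opposite signs and cancel in the
  product.\<close>

lemma theta_translates_in_theta_space: "(\<lambda>v. theta (v - b) * theta (v + b)) \<in> theta_space \<tau>"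
proof -
  have hol: "(\<lambda>v. theta (v - b) * theta (v + b)) holomorphic_on UNIV"
    using entire_affine[OF theta_holomorphic, of 1 b] entire_affine[OF theta_holomorphic, of 1 "-b"]
    by (auto intro: holomorphic_intros)
  have "theta (v + of_real pi - b) * theta (v + of_real pi + b) = theta (v - b) * theta (v + b)" for v
    using theta_add_pi[of "v - b"] theta_add_pi[of "v + b"] by (simp add: algebra_simps)
  moreover have "theta (v + of_real pi * \<tau> - b) * theta (v + of_real pi * \<tau> + b) =
      exp (- 2 * \<i> * of_real pi * \<tau> - 4 * \<i> * v) * (theta (v - b) * theta (v + b))" for v
  proof -
    have "theta (v + of_real pi * \<tau> - b) * theta (v + of_real pi * \<tau> + b) =
          theta ((v - b) + of_real pi * \<tau>) * theta ((v + b) + of_real pi * \<tau>)"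
      by (simp add: algebra_simps)
    also have "\<dots> = (exp (- \<i> * of_real pi * \<tau> - 2 * \<i> * (v - b)) * exp (- \<i> * of_real pi * \<tau> - 2 * \<i> * (v + b))) *
        (theta (v - b) * theta (v + b))"
      unfolding theta_add_pi_tau by simp
    also have "exp (- \<i> * of_real pi * \<tau> - 2 * \<i> * (v - b)) * exp (- \<i> * of_real pi * \<tau> - 2 * \<i> * (v + b)) =
        exp (- 2 * \<i> * of_real pi * \<tau> - 4 * \<i> * v)"
      unfolding exp_add [symmetric] by (rule arg_cong[of _ _ exp]) (simp add: algebra_simps)
    finally show ?thesis .
  qed
  ultimately show ?thesis using hol by (simp add: theta_space_def)
qed

lemma theta_square_in_theta_space: "(\<lambda>v. (theta v)\<^sup>2) \<in> theta_space \<tau>"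
  using theta_translates_in_theta_space[of 0] by (simp add: power2_eq_square)

text \<open>After cancelling the square of \<open>theta_quotient\<close>, evaluate at 0: sigma
  vanishes while \<open>wp_numerator\<close> is 1. In other words, \<open>wp\<close> has a pole
  there.\<close>

lemma theta_square_wp_theta_square_independent:
  assumes "\<And>v. x * (theta v)\<^sup>2 + y * wp_theta_square v = 0"
  shows "x = 0 \<and> y = 0"
proof -
  obtain v0 where v0: "theta v0 \<noteq> 0" by (rule theta_nonzero)
  hence H0: "(theta_quotient v0)\<^sup>2 \<noteq> 0" by (auto simp: theta_eq)
  have "x * (sigma_scaled v)\<^sup>2 + y * wp_numerator v = 0" for v
  proof (rule entire_mult_eq_0[of "\<lambda>v. x * (sigma_scaled v)\<^sup>2 + y * wp_numerator v" "\<lambda>v. (theta_quotient v)\<^sup>2" v0])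
    show "(x * (sigma_scaled v)\<^sup>2 + y * wp_numerator v) * (theta_quotient v)\<^sup>2 = 0" for v
      using assms[of v] by (simp add: theta_eq wp_theta_square_def algebra_simps power_mult_distrib)
  qed (use H0 in \<open>auto intro!: holomorphic_intros sigma_scaled_holomorphic wp_numerator_holomorphic theta_quotient_holomorphic\<close>)
  from this[of 0] have "y = 0"
    using lattice_0 by (simp add: sigma_scaled_eq_0_iff[THEN iffD2] wp_numerator_0)
  thus ?thesis using assms[of v0] v0 by simp
qed

lemma theta_space_basis:
  assumes "f \<in> theta_space \<tau>"
  shows "\<exists>x y. \<forall>v. f v = x * (theta v)\<^sup>2 + y * wp_theta_square v"
  by (rule theta_space_span[OF theta_square_in_theta_space wp_theta_square_in_theta_space assms])
     (intro allI impI, rule theta_square_wp_theta_square_independent, erule spec)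

section \<open>Zeros of theta and the factorisation of differences of \<open>wp\<close>\<close>

lemma theta_eq_0_iff: "theta \<alpha> = 0 \<longleftrightarrow> scale * \<alpha> \<in> \<Lambda>"
proof
  assume g0: "theta \<alpha> = 0"
  show "scale * \<alpha> \<in> \<Lambda>"
  proof (rule ccontr)
    assume "scale * \<alpha> \<notin> \<Lambda>"
    hence W0: "wp_theta_square \<alpha> = 0" by (simp add: wp_theta_square_eq g0)
    have prod: "theta (\<alpha> - b) * theta (\<alpha> + b) = 0" for b
    proof -
      from theta_space_basis[OF theta_translates_in_theta_space[of b]]
      obtain x y where "\<forall>v. theta (v - b) * theta (v + b) = x * (theta v)\<^sup>2 + y * wp_theta_square v"
        by (elim exE)
      from spec[OF this, of \<alpha>] show ?thesis by (simp add: g0 W0)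
    qed
    obtain v0 where v0: "theta v0 \<noteq> 0" by (rule theta_nonzero)
    \<comment> \<open>The product is now read as a function of \<open>b\<close>. Its second factor
      is nonzero at b = v0 - \<alpha>, so the first vanishes identically, including at b = \<alpha>
      - v0, where it is \<open>theta v0\<close>.\<close>
    have "theta (\<alpha> - b) = 0" for b
    proof (rule entire_mult_eq_0[of "\<lambda>b. theta (\<alpha> - b)" "\<lambda>b. theta (\<alpha> + b)" "v0 - \<alpha>"])
      show "(\<lambda>b. theta (\<alpha> - b)) holomorphic_on UNIV" "(\<lambda>b. theta (\<alpha> + b)) holomorphic_on UNIV"
        using entire_affine[OF theta_holomorphic, of "-1" \<alpha>] entire_affine[OF theta_holomorphic, of 1 \<alpha>]
        by (simp_all add: add.commute)
    qed (use prod v0 in auto)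
    from this[of "\<alpha> - v0"] v0 show False by simp
  qed
qed (rule theta_eq_0_on_lattice)

text \<open>The scalar y is tied to the derivative at 0 by an equation without quotients, so that it
  can be eliminated by multiplication, with no division by \<open>deriv theta 0\<close>.\<close>

lemma theta_translates_eq:
  assumes "scale * \<alpha> \<notin> \<Lambda>"
  shows "\<exists>y. scale\<^sup>2 * (theta \<alpha>)\<^sup>2 = - y * (deriv theta 0)\<^sup>2 \<and>
    (\<forall>v. scale * v \<notin> \<Lambda> \<longrightarrow> theta (v - \<alpha>) * theta (v + \<alpha>) = y * (theta v)\<^sup>2 * (wp (scale * v) - wp (scale * \<alpha>)))"
proof -
  from theta_space_basis[OF theta_translates_in_theta_space[of \<alpha>]]
  obtain x y where "\<forall>v. theta (v - \<alpha>) * theta (v + \<alpha>) = x * (theta v)\<^sup>2 + y * wp_theta_square v"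
    by (elim exE)
  note xy = spec[OF this]
  \<comment> \<open>At v = \<alpha> the left-hand side contains the factor \<open>theta 0\<close>,
    which is 0.\<close>
  have "(x + y * wp (scale * \<alpha>)) * (theta \<alpha>)\<^sup>2 = 0"
    using xy[of \<alpha>] assms by (simp add: theta_0 wp_theta_square_eq distrib_right mult.assoc)
  hence x: "x = - y * wp (scale * \<alpha>)"
    using assms theta_eq_0_iff[of \<alpha>] by (simp add: eq_neg_iff_add_eq_0)
  have "- (theta \<alpha>)\<^sup>2 = y * wp_theta_square 0"
    using xy[of 0] by (simp add: theta_0 theta_uminus power2_eq_square)
  hence "(theta \<alpha>)\<^sup>2 = - y * wp_theta_square 0"
    by (simp add: minus_equation_iff[of "(theta \<alpha>)\<^sup>2"])
  hence "scale\<^sup>2 * (theta \<alpha>)\<^sup>2 = - y * (deriv theta 0)\<^sup>2"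
    by (simp add: deriv_theta_0 mult_ac)
  moreover have "theta (v - \<alpha>) * theta (v + \<alpha>) = y * (theta v)\<^sup>2 * (wp (scale * v) - wp (scale * \<alpha>))"
    if "scale * v \<notin> \<Lambda>" for v
    unfolding xy[of v] x wp_theta_square_eq[OF that] by (simp add: right_diff_distrib)
  ultimately show ?thesis by blast
qed

lemma wp_eq_imp:
  assumes "scale * \<alpha> \<notin> \<Lambda>" "scale * \<beta> \<notin> \<Lambda>" "wp (scale * \<beta>) = wp (scale * \<alpha>)"
  shows "scale * (\<beta> - \<alpha>) \<in> \<Lambda> \<or> scale * (\<beta> + \<alpha>) \<in> \<Lambda>"
proof -
  from theta_translates_eq[OF assms(1)] have "theta (\<beta> - \<alpha>) * theta (\<beta> + \<alpha>) = 0"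
    using assms(2,3) by auto
  thus ?thesis by (simp add: theta_eq_0_iff)
qed

text \<open>Theta form of the classical identity wp(z) - wp(a) = - sigma(z - a) sigma(z + a) /
  (sigma(z)^2 sigma(a)^2).\<close>

lemma wp_diff_eq_theta:
  assumes "scale * \<alpha> \<notin> \<Lambda>" "scale * v \<notin> \<Lambda>"
  shows "wp (scale * v) - wp (scale * \<alpha>) =
           - (deriv theta 0)\<^sup>2 * (theta (v - \<alpha>) * theta (v + \<alpha>)) / (scale\<^sup>2 * (theta \<alpha>)\<^sup>2 * (theta v)\<^sup>2)"
proof -
  obtain y where y: "scale\<^sup>2 * (theta \<alpha>)\<^sup>2 = - y * (deriv theta 0)\<^sup>2"
    "theta (v - \<alpha>) * theta (v + \<alpha>) = y * (theta v)\<^sup>2 * (wp (scale * v) - wp (scale * \<alpha>))"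
    using theta_translates_eq[OF assms(1)] assms(2) by blast
  have nz: "scale\<^sup>2 * (theta \<alpha>)\<^sup>2 * (theta v)\<^sup>2 \<noteq> 0"
    using assms scale_nonzero by (simp add: theta_eq_0_iff)
  have "(wp (scale * v) - wp (scale * \<alpha>)) * (scale\<^sup>2 * (theta \<alpha>)\<^sup>2 * (theta v)\<^sup>2) = - (deriv theta 0)\<^sup>2 * (theta (v - \<alpha>) * theta (v + \<alpha>))"
    unfolding y by simp
  with nz show ?thesis by (simp only: eq_divide_eq) simp
qed

end

text \<open>The points are kept off the lattice because the values of \<open>weierstrass_p\<close>
  at its poles carry no meaning. The condition on \<alpha>\<open>\<^sub>1\<close> +
  \<alpha>\<open>\<^sub>2\<close> excludes a component m along \<open>2 * \<omega>\<^sub>2\<close>.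
  Such a component would change the right-hand side by a constant multiple of exp(2 i m v), with v =
  pi z / (2 omega_1), since theta is only quasi-periodic in that direction.\<close>

theorem theorem2:
  fixes \<omega>\<^sub>1 \<omega>\<^sub>2 \<tau> a \<alpha>\<^sub>1 \<alpha>\<^sub>2 C z :: complex and \<Lambda> :: "complex set"
  assumes "Im (\<omega>\<^sub>2 / \<omega>\<^sub>1) > 0"
    and "\<Lambda> = period_lattice \<omega>\<^sub>1 \<omega>\<^sub>2"
    and "\<tau> = \<omega>\<^sub>2 / \<omega>\<^sub>1"
    and "a \<noteq> weierstrass_p \<Lambda> \<omega>\<^sub>1"
    and "a \<noteq> weierstrass_p \<Lambda> \<omega>\<^sub>2"
    and "a \<noteq> weierstrass_p \<Lambda> (\<omega>\<^sub>1 + \<omega>\<^sub>2)"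
    and "\<alpha>\<^sub>1 \<notin> \<Lambda>" and "weierstrass_p \<Lambda> \<alpha>\<^sub>1 = a"
    and "\<alpha>\<^sub>2 \<notin> \<Lambda>" and "weierstrass_p \<Lambda> \<alpha>\<^sub>2 = a"
    and "\<And>n m :: int. \<alpha>\<^sub>1 - \<alpha>\<^sub>2 \<noteq> 2 * of_int n * \<omega>\<^sub>1 + 2 * of_int m * \<omega>\<^sub>2"
    and "\<And>n m :: int. m \<noteq> 0 \<Longrightarrow> \<alpha>\<^sub>1 + \<alpha>\<^sub>2 \<noteq> 2 * of_int n * \<omega>\<^sub>1 + 2 * of_int m * \<omega>\<^sub>2"
    and "C = (of_real pi)\<^sup>2 / (4 * \<omega>\<^sub>1\<^sup>2) * (deriv (\<lambda>u. theta1 u \<tau>) 0)\<^sup>2 /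
             (theta1 (of_real pi * \<alpha>\<^sub>1 / (2 * \<omega>\<^sub>1)) \<tau> * theta1 (of_real pi * \<alpha>\<^sub>2 / (2 * \<omega>\<^sub>1)) \<tau>)"
    and "z \<notin> \<Lambda>"
  shows "weierstrass_p \<Lambda> z - a =
           C * (theta1 (of_real pi * z / (2 * \<omega>\<^sub>1) - of_real pi * \<alpha>\<^sub>1 / (2 * \<omega>\<^sub>1)) \<tau> *
                theta1 (of_real pi * z / (2 * \<omega>\<^sub>1) - of_real pi * \<alpha>\<^sub>2 / (2 * \<omega>\<^sub>1)) \<tau>) /
           (theta1 (of_real pi * z / (2 * \<omega>\<^sub>1)) \<tau>)\<^sup>2"
proof -
  interpret L: complex_lattice \<omega>\<^sub>1 \<omega>\<^sub>2
    by standard (rule assms(1))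
  have \<Lambda>: "\<Lambda> = L.\<Lambda>" and \<tau>: "\<tau> = L.\<tau>"
    by (simp_all add: assms(2,3) L.\<Lambda>_def L.\<tau>_def)
  define v a1 a2 where "v = of_real pi * z / (2 * \<omega>\<^sub>1)" and "a1 = of_real pi * \<alpha>\<^sub>1 / (2 * \<omega>\<^sub>1)"
    and "a2 = of_real pi * \<alpha>\<^sub>2 / (2 * \<omega>\<^sub>1)"
  have scaled: "L.scale * v = z" "L.scale * a1 = \<alpha>\<^sub>1" "L.scale * a2 = \<alpha>\<^sub>2"
    using L.\<omega>\<^sub>1_nonzero by (simp_all add: L.scale_def v_def a1_def a2_def)
  have "L.scale * (a2 - a1) \<in> L.\<Lambda> \<or> L.scale * (a2 + a1) \<in> L.\<Lambda>"
    by (rule L.wp_eq_imp) (use assms(7-10) in \<open>simp_all add: scaled \<Lambda>\<close>)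
  moreover have "L.scale * (a2 - a1) \<notin> L.\<Lambda>"
  proof
    assume "L.scale * (a2 - a1) \<in> L.\<Lambda>"
    hence "\<alpha>\<^sub>1 - \<alpha>\<^sub>2 \<in> period_lattice \<omega>\<^sub>1 \<omega>\<^sub>2"
      using L.lattice_uminus by (fastforce simp: right_diff_distrib scaled L.\<Lambda>_def)
    thus False using assms(11) by (auto simp: period_lattice_def)
  qed
  ultimately have "\<alpha>\<^sub>1 + \<alpha>\<^sub>2 \<in> period_lattice \<omega>\<^sub>1 \<omega>\<^sub>2"
    by (simp add: distrib_left scaled L.\<Lambda>_def add.commute)
  then obtain m n :: int where "\<alpha>\<^sub>1 + \<alpha>\<^sub>2 = 2 * of_int m * \<omega>\<^sub>1 + 2 * of_int n * \<omega>\<^sub>2"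
    by (auto simp: period_lattice_def)
  \<comment> \<open>Here \<open>n\<close> is the coefficient of \<open>\<omega>\<^sub>2\<close>,
    which the condition on the sum forces to be 0. What remains is a shift by a multiple of pi in
    the theta variable.\<close>
  with assms(12)[of n m] have sum: "\<alpha>\<^sub>2 = 2 * of_int m * \<omega>\<^sub>1 - \<alpha>\<^sub>1"
    by (cases "n = 0") (auto simp: algebra_simps)
  have a2: "a2 = - a1 + of_int m * of_real pi"
    using L.\<omega>\<^sub>1_nonzero by (simp add: a1_def a2_def sum field_simps)
  obtain \<epsilon> where \<epsilon>: "\<epsilon> * \<epsilon> = 1" "\<And>v. L.theta (v + of_int m * of_real pi) = \<epsilon> * L.theta v"
    using antiperiodic_of_int[of L.theta "of_real pi" m] L.theta_add_pi by blast
  have theta_a2: "L.theta a2 = - \<epsilon> * L.theta a1"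
    unfolding a2 \<epsilon>(2) L.theta_uminus by simp
  have "v + a1 = v - a2 + of_int m * of_real pi"
    by (simp add: a2)
  hence "L.theta (v + a1) = \<epsilon> * L.theta (v - a2)"
    by (simp only: \<epsilon>(2))
  hence "\<epsilon> * L.theta (v + a1) = (\<epsilon> * \<epsilon>) * L.theta (v - a2)"
    by (simp only: mult.assoc)
  hence theta_diff: "L.theta (v - a2) = \<epsilon> * L.theta (v + a1)"
    by (simp only: \<epsilon>(1) mult_1)
  have \<epsilon>0: "\<epsilon> \<noteq> 0" using \<epsilon>(1) by auto
  have c2: "(of_real pi)\<^sup>2 / (4 * \<omega>\<^sub>1\<^sup>2) = 1 / L.scale\<^sup>2"
    by (simp add: L.scale_def power_divide power_mult_distrib)
  have C: "C = 1 / L.scale\<^sup>2 * (deriv L.theta 0)\<^sup>2 / (L.theta a1 * L.theta a2)"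
    unfolding assms(13) c2 by (simp add: L.theta_def [abs_def] \<tau> a1_def a2_def)
  have "weierstrass_p \<Lambda> z - a = L.wp (L.scale * v) - L.wp (L.scale * a1)"
    using assms(8) by (simp add: scaled \<Lambda>)
  also have "\<dots> = - (deriv L.theta 0)\<^sup>2 * (L.theta (v - a1) * L.theta (v + a1)) / (L.scale\<^sup>2 * (L.theta a1)\<^sup>2 * (L.theta v)\<^sup>2)"
    by (rule L.wp_diff_eq_theta) (use assms in \<open>simp_all only: scaled \<Lambda> not_False_eq_True\<close>)
  \<comment> \<open>The sign \<epsilon> occurs in the numerator through \<open>theta_diff\<close>
    and in the denominator of \<open>C\<close> through \<open>theta_a2\<close>, so it cancels. The
    minus sign in \<open>theta_a2\<close>, due to oddness, accounts for the one in the previous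
    formula.\<close>
  also have "\<dots> = C * (L.theta (v - a1) * L.theta (v - a2)) / (L.theta v)\<^sup>2"
    using \<epsilon>0 by (simp add: C theta_a2 theta_diff power2_eq_square mult_ac)
  finally show ?thesis
    unfolding L.theta_def \<tau> v_def a1_def a2_def .
qed

end
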